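(* Let $S$ be a string of length $n$ of integers in $[0,\sigma)$, and let $\mathcal{S}$ be an SLP (straight-line program) grammar compression of $S$. Then there is a data structure of size $O(|\mathcal{S}|)$ (in words, in the word-RAM model) that, given any indices $1\le i\le j\le n$, returns $\mathrm{RMQ}(i,j)$ in $O(\log n)$ time.
   Context: For a string $S$ of integers, the range minimum query $\mathrm{RMQ}(i,j)$ returns the index of the smallest integer in $S[i\dots j]$. An SLP $\mathcal{S}$ for $S$ is a context-free grammar generating exactly the string $S$, in which the right-hand side of every rule is either the concatenation of two nonterminals or a single terminal symbol; the size $|\mathcal{S}|$ is the number of rules. *)

theory Defs
  imports Complex_Main "HOL-Library.Landau_Symbols"
begin

section \<open>Context-free grammars and straight-line programs\<close>

datatype ('n, 't) sym = Nt 'n | Tm 't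

type_synonym ('n, 't) prods = "('n \<times> ('n, 't) sym list) set"

inductive derive_step :: "('n, 't) prods \<Rightarrow> ('n, 't) sym list \<Rightarrow> ('n, 't) sym list \<Rightarrow> bool"
  for P where
  "(A, \<alpha>) \<in> P \<Longrightarrow> derive_step P (u @ [Nt A] @ v) (u @ \<alpha> @ v)"

definition Lang :: "('n, 't) prods \<Rightarrow> 'n \<Rightarrow> 't list set" where
  "Lang P A = {s. (derive_step P)\<^sup>*\<^sup>* [Nt A] (map Tm s)}"

text \<open>The size of an SLP \<open>P\<close>, its number of rules, is \<^term>\<open>card P\<close>.
  A nonterminal is not required to have a unique rule, and rules that do not occur in the
  derivation of \<open>s\<close> are allowed; both only make the notion more general.\<close>

definition is_slp :: "('n, 't) prods \<Rightarrow> 'n \<Rightarrow> 't list \<Rightarrow> bool" where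
  "is_slp P A s \<longleftrightarrow>
     finite P \<and>
     (\<forall>(B, \<alpha>) \<in> P. (\<exists>C D. \<alpha> = [Nt C, Nt D]) \<or> (\<exists>a. \<alpha> = [Tm a])) \<and>
     Lang P A = {s}"

section \<open>Range minimum queries\<close>

text \<open>Positions are counted from 1. Ties are broken in favour of the leftmost minimum.\<close>

definition rmq :: "int list \<Rightarrow> nat \<Rightarrow> nat \<Rightarrow> nat" where
  "rmq S i j = (LEAST k. k \<in> {i..j} \<and> (\<forall>l \<in> {i..j}. S ! (k - 1) \<le> S ! (l - 1)))"

section \<open>The word RAM\<close>

text \<open>Words of \<open>w\<close> bits are represented by natural numbers below \<open>2 ^ w\<close>. A program does not
  depend on \<open>w\<close> and uses finitely many registers. Each instruction has unit cost, and a program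
  stops when control leaves it.\<close>

datatype binop = Add | Sub | Mul | Div | Mod | And | Or | Xor | Shl | Shr

fun exec_op :: "nat \<Rightarrow> binop \<Rightarrow> nat \<Rightarrow> nat \<Rightarrow> nat" where
  "exec_op w Add a b = take_bit w (a + b)"
| "exec_op w Sub a b = take_bit w (a + 2 ^ w - b)" \<comment> \<open>two's complement, as \<open>b < 2 ^ w\<close>\<close>
| "exec_op w Mul a b = take_bit w (a * b)"
| "exec_op w Div a b = a div b"
| "exec_op w Mod a b = a mod b"
| "exec_op w And a b = and a b"
| "exec_op w Or a b = or a b"
| "exec_op w Xor a b = xor a b"
| "exec_op w Shl a b = take_bit w (push_bit b a)"
| "exec_op w Shr a b = drop_bit b a"

type_synonym reg = nat

datatype instr =
    Const reg nat            \<comment> \<open>\<open>r := c\<close>\<close>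
  | Op binop reg reg reg     \<comment> \<open>\<open>r := s \<circ> t\<close>\<close>
  | Load reg reg             \<comment> \<open>\<open>r := mem[s]\<close>\<close>
  | Store reg reg            \<comment> \<open>\<open>mem[r] := s\<close>\<close>
  | Jump nat
  | JumpEq reg reg nat       \<comment> \<open>jump if \<open>r = s\<close>\<close>
  | JumpLess reg reg nat     \<comment> \<open>jump if \<open>r < s\<close>\<close>

type_synonym program = "instr list"

record config =
  pc :: nat
  regs :: "reg \<Rightarrow> nat"
  mem :: "nat \<Rightarrow> nat"

fun exec_instr :: "nat \<Rightarrow> instr \<Rightarrow> config \<Rightarrow> config" where
  "exec_instr w (Const r k) c =
     c\<lparr>pc := pc c + 1, regs := (regs c)(r := take_bit w k)\<rparr>"
| "exec_instr w (Op f r s t) c =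
     c\<lparr>pc := pc c + 1, regs := (regs c)(r := exec_op w f (regs c s) (regs c t))\<rparr>"
| "exec_instr w (Load r s) c =
     c\<lparr>pc := pc c + 1, regs := (regs c)(r := mem c (regs c s))\<rparr>"
| "exec_instr w (Store r s) c =
     c\<lparr>pc := pc c + 1, mem := (mem c)(regs c r := regs c s)\<rparr>"
| "exec_instr w (Jump l) c = c\<lparr>pc := l\<rparr>"
| "exec_instr w (JumpEq r s l) c =
     c\<lparr>pc := (if regs c r = regs c s then l else pc c + 1)\<rparr>"
| "exec_instr w (JumpLess r s l) c =
     c\<lparr>pc := (if regs c r < regs c s then l else pc c + 1)\<rparr>"

definition halted :: "program \<Rightarrow> config \<Rightarrow> bool" where
  "halted p c \<longleftrightarrow> length p \<le> pc c"

definition step :: "nat \<Rightarrow> program \<Rightarrow> config \<Rightarrow> config" where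
  "step w p c = (if halted p c then c else exec_instr w (p ! pc c) c)"

definition halts_within :: "nat \<Rightarrow> program \<Rightarrow> nat \<Rightarrow> config \<Rightarrow> config \<Rightarrow> bool" where
  "halts_within w p t c c' \<longleftrightarrow> halted p c' \<and> (\<exists>k \<le> t. (step w p ^^ k) c = c')"

definition start :: "nat \<Rightarrow> nat \<Rightarrow> (nat \<Rightarrow> nat) \<Rightarrow> config" where
  "start i j m = \<lparr>pc = 0, regs = (\<lambda>_. 0)(0 := i, 1 := j), mem = m\<rparr>"

text \<open>The list \<open>D\<close> of words occupies the memory cells \<open>0, \<dots>, length D - 1\<close>.\<close>

definition stores :: "(nat \<Rightarrow> nat) \<Rightarrow> nat list \<Rightarrow> bool" where
  "stores m D \<longleftrightarrow> (\<forall>a < length D. m a = D ! a)"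

text \<open>The program \<open>query\<close> answers every range minimum query on \<open>S\<close> in at most \<open>t\<close> steps, given
  the data structure \<open>D\<close> in memory. The memory outside \<open>D\<close> is available as working space and has
  arbitrary initial contents. A query must leave \<open>D\<close> intact, so that it can be followed
  by further queries.\<close>

definition answers_rmq :: "nat \<Rightarrow> program \<Rightarrow> nat \<Rightarrow> nat list \<Rightarrow> int list \<Rightarrow> bool" where
  "answers_rmq w query t D S \<longleftrightarrow>
     (\<forall>i j m. 1 \<le> i \<and> i \<le> j \<and> j \<le> length S \<and> stores m D \<and> (\<forall>a. m a < 2 ^ w) \<longrightarrow>
        (\<exists>c. halts_within w query t (start i j m) c \<and> regs c 0 = rmq S i j \<and> stores (mem c) D))"

end

theory Submission
  imports Defs "HOL-Library.Discrete_Functions" "HOL-Library.Sublist"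
begin

text \<open>
  The derivation tree of the SLP is rebalanced along its symmetric centroid paths (Ganardi, Jez
  and Lohrey): its height becomes logarithmic while the number of distinct subtrees stays linear.
  Give a subtree with \<open>\<ell>\<close> leaves that occurs \<open>k\<close> times the rank
  \<open>\<lfloor>log \<ell>\<rfloor> + \<lfloor>log n\<rfloor> - \<lfloor>log k\<rfloor>\<close>. It does not increase from a node to its children, and
  the edges between nodes of equal rank form disjoint paths. The lengths of the strings
  on such a path differ by a factor less than 2, so each of them can be rebuilt from shared
  weight-balanced trees over the subtrees hanging off to the left and to the right, at the cost of
  an additive constant to the height per rank.

  The data structure stores five words for every distinct subtree of the balanced tree. A query
  walks down to the node where the range splits, and then along one path on either side. Only the
  order of the integers matters, so they are replaced by their ranks, which fit into a word.
\<close>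

section \<open>Binary trees and their subtrees\<close>

text \<open>Why the paths are disjoint: if two children had the same \<open>floor_log\<close> of the
  leaf count as their parent, or two parents the same \<open>floor_log\<close> of the occurrences as
  their child, the sum of the two numbers would already reach the next power of two. Leaf counts
  alone would leave a node with at most one successor but possibly many predecessors, and merging
  paths cannot be charged to their nodes. Two demands shape the trees along a path. The logarithms
  must telescope: trees of height \<open>h + 2 log l\<close> over \<open>l\<close> leaves have to
  combine into one of height \<open>h + 2 log W + O(1)\<close> over all \<open>W\<close> leaves, so
  that only the constant accumulates, once per rank. And the number of new nodes must be linear in
  the length of the path, although cutting each of \<open>k\<close> suffixes out of one balanced
  tree would cost about \<open>k log k\<close>. A path pays at most 31 new nodes for each of its
  nodes, a rank at most 10 levels. The root has rank \<open>2 * floor_log n\<close>, which leads to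
  the height \<open>22 * floor_log n + 12\<close>.\<close>

datatype 'a btree = Leaf 'a | Node "'a btree" "'a btree"

fun frontier :: "'a btree \<Rightarrow> 'a list" where
  "frontier (Leaf a) = [a]"
| "frontier (Node l r) = frontier l @ frontier r"

fun height :: "'a btree \<Rightarrow> nat" where
  "height (Leaf a) = 0"
| "height (Node l r) = Suc (max (height l) (height r))"

fun subtrees :: "'a btree \<Rightarrow> 'a btree set" where
  "subtrees (Leaf a) = {Leaf a}"
| "subtrees (Node l r) = insert (Node l r) (subtrees l \<union> subtrees r)"

fun mirror :: "'a btree \<Rightarrow> 'a btree" where
  "mirror (Leaf a) = Leaf a"
| "mirror (Node l r) = Node (mirror r) (mirror l)"

fun flat :: "'a btree btree \<Rightarrow> 'a btree" where
  "flat (Leaf x) = x"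
| "flat (Node l r) = Node (flat l) (flat r)"

text \<open>Leaves may stand for trees of height \<open>f\<close>. With real values and arbitrary
  \<open>f\<close>, one balancing lemma bounds both the expanded height and, for
  \<open>f = 0\<close>, the number of levels.\<close>

fun height_with :: "('a \<Rightarrow> real) \<Rightarrow> 'a btree \<Rightarrow> real" where
  "height_with f (Leaf a) = f a"
| "height_with f (Node l r) = 1 + max (height_with f l) (height_with f r)"

lemma frontier_neq_Nil [simp]: "frontier t \<noteq> []"
  by (induction t) auto

lemma length_frontier_pos [simp]: "0 < length (frontier t)"
  by simp

lemma finite_subtrees [simp]: "finite (subtrees t)"
  by (induction t) auto

lemma self_in_subtrees [simp]: "t \<in> subtrees t"
  by (cases t) auto

lemma subtrees_trans: "u \<in> subtrees t \<Longrightarrow> v \<in> subtrees u \<Longrightarrow> v \<in> subtrees t"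
  by (induction t) auto

lemma subtrees_Node_in: "Node x y \<in> subtrees t \<Longrightarrow> x \<in> subtrees t" "Node x y \<in> subtrees t \<Longrightarrow> y \<in> subtrees t"
  by (auto intro: subtrees_trans[of "Node x y"])

lemma length_frontier_subtrees: "u \<in> subtrees t \<Longrightarrow> length (frontier u) \<le> length (frontier t)"
  by (induction t) auto

lemma card_subtrees_le: "card (subtrees t) \<le> 2 * length (frontier t) - 1"
proof (induction t)
  case (Node l r)
  have "card (subtrees (Node l r)) \<le> Suc (card (subtrees l \<union> subtrees r))"
    by (simp add: card_insert_if)
  also have "\<dots> \<le> Suc (card (subtrees l) + card (subtrees r))"
    using card_Un_le by blast
  finally show ?case
    using Node length_frontier_pos[of l] length_frontier_pos[of r] by (simp del: length_frontier_pos length_greater_0_conv)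
qed auto

lemma frontier_mirror [simp]: "frontier (mirror t) = rev (frontier t)"
  by (induction t) auto

lemma height_mirror [simp]: "height (mirror t) = height t"
  by (induction t) auto

lemma subtrees_mirror: "subtrees (mirror t) = mirror ` subtrees t"
  by (induction t) auto

lemma mirror_mirror [simp]: "mirror (mirror t) = t"
  by (induction t) auto

lemma frontier_flat: "frontier (flat B) = concat (map frontier (frontier B))"
  by (induction B) auto

lemma height_flat: "real (height (flat B)) = height_with (\<lambda>x. real (height x)) B"
  by (induction B) auto

lemma height_eq_height_with: "real (height B) = height_with (\<lambda>_. 0) B"
  by (induction B) auto

lemma subtrees_flat: "subtrees (flat B) \<subseteq> flat ` subtrees B \<union> \<Union> (subtrees ` set (frontier B))"
  by (induction B) (auto simp: image_iff)

section \<open>Weight-balanced trees and their suffixes\<close>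

lemma weighted_split:
  fixes w :: "'a \<Rightarrow> nat"
  assumes "xs \<noteq> []" "\<theta> \<le> sum_list (map w xs)"
  shows "\<exists>us c vs. xs = us @ c # vs \<and> sum_list (map w us) \<le> \<theta> \<and> \<theta> \<le> sum_list (map w us) + w c"
  using assms
proof (induction xs arbitrary: \<theta>)
  case (Cons x xs)
  show ?case
  proof (cases "\<theta> \<le> w x")
    case True
    then show ?thesis by (intro exI[of _ "[]"]) auto
  next
    case False
    with Cons.prems have ne: "xs \<noteq> []" by auto
    from False Cons.prems have "\<theta> - w x \<le> sum_list (map w xs)" by auto
    from Cons.IH[OF ne this] obtain us c vs where
      "xs = us @ c # vs" "sum_list (map w us) \<le> \<theta> - w x" "\<theta> - w x \<le> sum_list (map w us) + w c"
      by blast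
    with False show ?thesis by (intro exI[of _ "x # us"]) auto
  qed
qed auto

text \<open>The list is split at the element that straddles half of the weight. Each side weighs at
  most half, which gains 2 in \<open>2 * log 2\<close>, and this pays for the two levels that join
  the sides and the middle element. The tree is chosen before \<open>f\<close> and \<open>h\<close>,
  because one tree is used with two different pairs.\<close>

lemma weight_balanced_tree:
  fixes w :: "'a \<Rightarrow> nat"
  assumes "xs \<noteq> []" "\<forall>x \<in> set xs. 0 < w x"
  shows "\<exists>B. frontier B = xs \<and>
    (\<forall>f h. (\<forall>x \<in> set xs. f x \<le> h + 2 * log 2 (w x)) \<longrightarrow>
       height_with f B \<le> h + 2 * log 2 (sum_list (map w xs)) + 2)"
  using assms
proof (induction xs rule: length_induct)
  case (1 xs)
  define W where "W = sum_list (map w xs)"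
  define H where "H = (\<lambda>f ys. \<lambda>h. (\<forall>x \<in> set ys. f x \<le> h + 2 * log 2 (real (w x))))"
  \<comment> \<open>Doubled weights replace the threshold \<open>W / 2\<close>, which need not be an
    integer.\<close>
  have "W \<le> sum_list (map (\<lambda>x. 2 * w x) xs)"
    by (simp add: W_def sum_list_const_mult)
  from weighted_split[OF 1(2) this] obtain us c vs where
    xs: "xs = us @ c # vs" and us: "2 * sum_list (map w us) \<le> W"
    and c: "W \<le> 2 * sum_list (map w us) + 2 * w c"
    by (auto simp: sum_list_const_mult)
  have vs: "2 * sum_list (map w vs) \<le> W"
    using c by (simp add: W_def xs)
  have half: "\<exists>B. frontier B = ys \<and> (\<forall>f h. H f xs h \<longrightarrow> height_with f B \<le> h + 2 * log 2 W)"
    if "ys \<noteq> []" "2 * sum_list (map w ys) \<le> W" "set ys \<subseteq> set xs" "length ys < length xs" for ys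
  proof -
    from 1(1)[rule_format, OF that(4,1)] that(3) 1(3) obtain B where B: "frontier B = ys"
      "\<And>f h. H f ys h \<Longrightarrow> height_with f B \<le> h + 2 * log 2 (sum_list (map w ys)) + 2"
      by (auto simp: H_def)
    have pos: "0 < sum_list (map w ys)"
      using that(1,3) 1(3) by (cases ys) auto
    then have "log 2 (real (2 * sum_list (map w ys))) \<le> log 2 W"
      using that(2) by (subst log_le_cancel_iff) auto
    moreover have "log 2 (real (2 * sum_list (map w ys))) = 1 + log 2 (sum_list (map w ys))"
      using log_mult[of 2 "real (sum_list (map w ys))" 2] pos
      by (simp add: mult.commute del: sum_list_eq_0_iff)
    ultimately have "2 * log 2 (sum_list (map w ys)) + 2 \<le> 2 * log 2 W"
      by linarith
    moreover have "H f ys h" if "H f xs h" for f h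
      using that \<open>set ys \<subseteq> set xs\<close> by (auto simp: H_def)
    ultimately have "\<forall>f h. H f xs h \<longrightarrow> height_with f B \<le> h + 2 * log 2 W"
      using B(2) by (smt (verit))
    with B(1) show ?thesis by blast
  qed
  have cW: "log 2 (w c) \<le> log 2 W"
    using 1(3) by (subst log_le_cancel_iff) (auto simp: W_def xs)
  have "\<exists>V. frontier V = c # vs \<and> (\<forall>f h. H f xs h \<longrightarrow> height_with f V \<le> h + 2 * log 2 W + 1)"
  proof (cases "vs = []")
    case True
    then show ?thesis using cW by (intro exI[of _ "Leaf c"]) (fastforce simp: H_def xs)
  next
    case False
    from half[OF False vs] obtain V where
      V: "frontier V = vs" "\<And>f h. H f xs h \<Longrightarrow> height_with f V \<le> h + 2 * log 2 W"
      by (auto simp: xs)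
    have "f c \<le> h + 2 * log 2 W" if "H f xs h" for f h
      using that cW by (fastforce simp: H_def xs)
    with V show ?thesis by (intro exI[of _ "Node (Leaf c) V"]) auto
  qed
  then obtain V where
    V: "frontier V = c # vs" "\<And>f h. H f xs h \<Longrightarrow> height_with f V \<le> h + 2 * log 2 W + 1"
    by blast
  have "\<exists>B. frontier B = xs \<and> (\<forall>f h. H f xs h \<longrightarrow> height_with f B \<le> h + 2 * log 2 W + 2)"
  proof (cases "us = []")
    case True
    with V show ?thesis by (intro exI[of _ V]) (fastforce simp: xs)
  next
    case False
    from half[OF False us] obtain U where
      U: "frontier U = us" "\<And>f h. H f xs h \<Longrightarrow> height_with f U \<le> h + 2 * log 2 W"
      by (auto simp: xs)
    have "height_with f (Node U V) \<le> h + 2 * log 2 W + 2" if "H f xs h" for f h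
      using U(2)[OF that] V(2)[OF that] by simp
    with U V show ?thesis by (intro exI[of _ "Node U V"]) (auto simp: xs)
  qed
  then show ?case by (simp add: H_def W_def)
qed

fun suffix_tree :: "nat \<Rightarrow> 'a btree \<Rightarrow> 'a btree" where
  "suffix_tree m (Leaf a) = Leaf a"
| "suffix_tree m (Node l r) =
     (if m \<le> length (frontier r) then suffix_tree m r else Node (suffix_tree (m - length (frontier r)) l) r)"

lemma frontier_suffix_tree:
  "0 < m \<Longrightarrow> m \<le> length (frontier t) \<Longrightarrow> frontier (suffix_tree m t) = drop (length (frontier t) - m) (frontier t)"
  by (induction m t rule: suffix_tree.induct) auto

lemma height_with_suffix_tree: "height_with f (suffix_tree m t) \<le> height_with f t"
  by (induction m t rule: suffix_tree.induct) auto

text \<open>New nodes arise only on the path to the cut; whatever lies to the right of it is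
  reused.\<close>

lemma subtrees_suffix_tree: "\<exists>P. finite P \<and> card P \<le> height t \<and> subtrees (suffix_tree m t) \<subseteq> subtrees t \<union> P"
proof (induction m t rule: suffix_tree.induct)
  case (1 m a)
  show ?case by (intro exI[of _ "{}"]) auto
next
  case (2 m l r)
  show ?case
  proof (cases "m \<le> length (frontier r)")
    case True
    from 2(1)[OF True] obtain P where
      "finite P" "card P \<le> height r" "subtrees (suffix_tree m r) \<subseteq> subtrees r \<union> P"
      by blast
    with True show ?thesis by (intro exI[of _ P]) auto
  next
    case False
    from 2(2)[OF False] obtain P where
      "finite P" "card P \<le> height l" "subtrees (suffix_tree (m - length (frontier r)) l) \<subseteq> subtrees l \<union> P"
      by blast
    with False show ?thesis
      by (intro exI[of _ "insert (suffix_tree m (Node l r)) P"]) (auto simp: card_insert_if)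
  qed
qed

section \<open>Sharing the suffixes of a list of trees\<close>

text \<open>\<open>G\<close> marks the suffixes that get a tree of their own. A comb collects the
  elements in front of the next marked suffix; it contains the comb of the tail as a right subtree,
  so each suffix adds only one node.\<close>

fun comb :: "('a btree list \<Rightarrow> bool) \<Rightarrow> 'a btree list \<Rightarrow> 'a btree" where
  "comb G (y # ys) = (if ys = [] \<or> G ys then y else Node y (comb G ys))"

fun after_comb :: "('a list \<Rightarrow> bool) \<Rightarrow> 'a list \<Rightarrow> 'a list" where
  "after_comb G [] = []"
| "after_comb G (y # ys) = (if ys = [] \<or> G ys then ys else after_comb G ys)"

lemma frontier_comb: "ys \<noteq> [] \<Longrightarrow> frontier (comb G ys) @ concat (map frontier (after_comb G ys)) = concat (map frontier ys)"
  by (induction ys) auto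

lemma suffix_after_comb: "suffix (after_comb G ys) ys"
  by (induction ys) (auto intro: suffix_ConsI)

lemma after_comb_stops: "after_comb G ys = [] \<or> G (after_comb G ys)"
  by (induction ys) auto

lemma subtrees_comb:
  "ys \<noteq> [] \<Longrightarrow> subtrees (comb G ys) \<subseteq> comb G ` {zs. zs \<noteq> [] \<and> suffix zs ys} \<union> \<Union> (subtrees ` set ys)"
proof (induction ys)
  case (Cons y ys)
  have "{zs. zs \<noteq> [] \<and> suffix zs (y # ys)} = insert (y # ys) {zs. zs \<noteq> [] \<and> suffix zs ys}"
    by (auto simp: suffix_Cons)
  with Cons show ?case by auto
qed auto

text \<open>A suffix whose length is a multiple of \<open>L\<close> ends the comb, so at most
  \<open>length ys mod L\<close> elements are collected, each costing at most one level.\<close>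

lemma height_comb:
  assumes "ys \<noteq> []" "\<not> G ys" "\<And>zs. suffix zs ys \<Longrightarrow> L dvd length zs \<Longrightarrow> zs = [] \<or> G zs"
    "\<And>zs. suffix zs ys \<Longrightarrow> zs \<noteq> [] \<Longrightarrow> \<not> G zs \<Longrightarrow> real (height (hd zs)) \<le> M"
  shows "real (height (comb G ys)) \<le> M + real (length ys mod L)"
  using assms
proof (induction ys)
  case (Cons y ys)
  have y: "real (height y) \<le> M"
    using Cons.prems(4)[of "y # ys"] Cons.prems(2) by simp
  show ?case
  proof (cases "ys = [] \<or> G ys")
    case True
    with y show ?thesis by auto
  next
    case False
    have "\<not> L dvd length (y # ys)"
      using Cons.prems(2) Cons.prems(3)[of "y # ys"] by auto
    then have mod: "length (y # ys) mod L = Suc (length ys mod L)"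
      by (auto simp: mod_Suc dvd_eq_mod_eq_0)
    have "real (height (comb G ys)) \<le> M + real (length ys mod L)"
      using Cons.IH False Cons.prems(3,4) by (meson suffix_ConsI)
    with y mod False show ?thesis by auto
  qed
qed auto

section \<open>Counting the suffixes that are cut out of the balanced tree\<close>

lemma card_suffixes: "card {ys. ys \<noteq> [] \<and> suffix ys xs} = length xs"
proof -
  have "set (suffixes xs) = insert [] {ys. ys \<noteq> [] \<and> suffix ys xs}"
    by auto
  moreover have "card (set (suffixes xs)) = Suc (length xs)"
    by (simp add: distinct_card distinct_suffixes)
  moreover have "finite {ys. ys \<noteq> [] \<and> suffix ys xs}"
    by (rule finite_subset[of _ "set (suffixes xs)"]) auto
  ultimately show ?thesis by simp
qed

lemma finite_suffixes: "finite {ys. ys \<noteq> [] \<and> suffix ys xs}"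
  by (rule finite_subset[of _ "set (suffixes xs)"]) auto

lemma card_suffixes_dvd:
  assumes "0 < L"
  shows "card {ys. ys \<noteq> [] \<and> suffix ys xs \<and> L dvd length ys} \<le> length xs div L"
proof -
  have "inj_on (\<lambda>ys. length ys div L) {ys. ys \<noteq> [] \<and> suffix ys xs \<and> L dvd length ys}"
  proof (rule inj_onI, clarify)
    fix ys zs
    assume *: "suffix ys xs" "suffix zs xs" "L dvd length ys" "L dvd length zs"
      "length ys div L = length zs div L"
    then have "length ys = length zs" by (metis dvd_div_mult_self)
    then show "ys = zs" using * by (metis suffix_same_cases suffix_order.antisym le_refl suffix_length_suffix)
  qed
  moreover have "(\<lambda>ys. length ys div L) ` {ys. ys \<noteq> [] \<and> suffix ys xs \<and> L dvd length ys} \<subseteq> {1..length xs div L}"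
  proof (clarify, simp, intro conjI)
    fix ys :: "'a list"
    assume ys: "ys \<noteq> []" "suffix ys xs" "L dvd length ys"
    then have "L \<le> length ys" by (auto dest: dvd_imp_le)
    then show "Suc 0 \<le> length ys div L"
      using assms by (simp add: Suc_le_eq div_greater_zero_iff)
    show "length ys div L \<le> length xs div L"
      using ys by (intro div_le_mono suffix_length_le)
  qed
  ultimately show ?thesis
    using card_inj_on_le[of "\<lambda>ys. length ys div L" _ "{1..length xs div L}"] by simp
qed

text \<open>Markov's inequality: different suffixes have heads at different positions, and the
  weights of the heads add up to at most the total.\<close>

lemma card_suffixes_heavy:
  fixes w :: "'a \<Rightarrow> nat"
  shows "card {ys. ys \<noteq> [] \<and> suffix ys xs \<and> W \<le> w (hd ys) * K} * W \<le> sum_list (map w xs) * K"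
proof (induction xs)
  case (Cons x xs)
  have fin: "finite {ys. ys \<noteq> [] \<and> suffix ys xs \<and> W \<le> w (hd ys) * K}"
    by (rule finite_subset[OF _ finite_suffixes[of xs]]) auto
  have eq: "{ys. ys \<noteq> [] \<and> suffix ys (x # xs) \<and> W \<le> w (hd ys) * K} =
      (if W \<le> w x * K then {x # xs} else {}) \<union> {ys. ys \<noteq> [] \<and> suffix ys xs \<and> W \<le> w (hd ys) * K}"
    by (auto simp: suffix_Cons)
  show ?case
  proof (cases "W \<le> w x * K")
    case True
    have "card {ys. ys \<noteq> [] \<and> suffix ys (x # xs) \<and> W \<le> w (hd ys) * K}
        \<le> Suc (card {ys. ys \<noteq> [] \<and> suffix ys xs \<and> W \<le> w (hd ys) * K})"
      unfolding eq using True fin by (simp add: card_insert_if)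
    then have "card {ys. ys \<noteq> [] \<and> suffix ys (x # xs) \<and> W \<le> w (hd ys) * K} * W
        \<le> Suc (card {ys. ys \<noteq> [] \<and> suffix ys xs \<and> W \<le> w (hd ys) * K}) * W"
      by (rule mult_le_mono1)
    also have "\<dots> \<le> w x * K + sum_list (map w xs) * K"
      using Cons True by simp
    finally show ?thesis by (simp add: add_mult_distrib)
  next
    case False
    then show ?thesis unfolding eq using Cons by (simp add: add_mult_distrib)
  qed
qed auto

text \<open>Cutting a suffix off a balanced tree \<open>B\<close> costs as many new nodes as \<open>B\<close> is high, about
  \<open>2 log k\<close>, so it is done only for the suffixes that begin with a tree of weight at least
  \<open>W / 2 ^ L\<close> or whose length is a multiple of \<open>L\<close>, where \<open>L\<close> is about \<open>(log k) / 2\<close>: these are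
  \<open>O(k / log k)\<close> many. Any other suffix is a comb of fewer than \<open>L\<close> light trees followed by one of
  these, and a light tree can afford the depth \<open>L\<close>. The weights \<open>k * w x + W\<close> keep the height
  of \<open>B\<close> logarithmic in \<open>k\<close>.\<close>

lemma suffix_trees:
  fixes xs :: "'a btree list"
  shows "\<exists>T F. finite F \<and> card F \<le> 28 * length xs \<and>
    (\<forall>ys. ys \<noteq> [] \<and> suffix ys xs \<longrightarrow>
       frontier (T ys) = concat (map frontier ys) \<and> subtrees (T ys) \<subseteq> F \<union> \<Union> (subtrees ` set xs) \<and>
       (\<forall>h. (\<forall>x \<in> set xs. real (height x) \<le> h + 2 * log 2 (length (frontier x))) \<longrightarrow>
          real (height (T ys)) \<le> h + 2 * log 2 (length (concat (map frontier xs))) + 5))"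
proof (cases "xs = []")
  case True
  then show ?thesis by (intro exI[of _ "\<lambda>_. undefined"] exI[of _ "{}"]) auto
next
  case False
  define k where "k = length xs"
  define w where "w = (\<lambda>x :: 'a btree. length (frontier x))"
  define W where "W = sum_list (map w xs)"
  have k: "0 < k" using False by (simp add: k_def)
  have wpos: "0 < w x" for x by (simp add: w_def)
  have "length zs \<le> sum_list (map w zs)" for zs
  proof (induction zs)
    case (Cons z zs)
    then show ?case using wpos[of z] by simp
  qed auto
  then have kW: "k \<le> W" by (simp add: k_def W_def)
  then have W: "0 < W" using k by simp
  have W_concat: "W = length (concat (map frontier xs))"
    by (simp add: W_def w_def length_concat comp_def)
  have "\<forall>x \<in> set xs. 0 < k * w x + W" using W by simp
  from weight_balanced_tree[OF False this] obtain B where B: "frontier B = xs"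
    "\<And>f h. \<forall>x \<in> set xs. f x \<le> h + 2 * log 2 (real (k * w x + W)) \<Longrightarrow>
       height_with f B \<le> h + 2 * log 2 (real (sum_list (map (\<lambda>x. k * w x + W) xs))) + 2"
    by blast
  have sumW: "sum_list (map (\<lambda>x. k * w x + W) xs) = 2 * k * W"
    by (simp add: sum_list_addf sum_list_const_mult sum_list_triv W_def k_def)
  have log2kW: "log 2 (real (2 * k * W)) = 1 + log 2 k + log 2 W"
    using k W by (simp add: log_mult)
  \<comment> \<open>Here each weight is bounded below by \<open>k * w x\<close>; the factor
    \<open>k\<close> cancels against the one in the total weight \<open>2 * k * W\<close>.\<close>
  have flatB: "real (height (flat B)) \<le> h + 2 * log 2 W + 4"
    if h: "\<forall>x \<in> set xs. real (height x) \<le> h + 2 * log 2 (w x)" for h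
  proof -
    have "real (height x) \<le> (h - 2 * log 2 k) + 2 * log 2 (real (k * w x + W))" if "x \<in> set xs" for x
    proof -
      have "log 2 (real (k * w x)) \<le> log 2 (real (k * w x + W))"
        using k W wpos[of x] by (subst log_le_cancel_iff) (auto intro!: add_nonneg_pos)
      moreover have "log 2 (real (k * w x)) = log 2 k + log 2 (w x)"
        using k wpos[of x] by (simp add: log_mult)
      ultimately show ?thesis using h that by fastforce
    qed
    then have "height_with (\<lambda>x. real (height x)) B \<le> (h - 2 * log 2 k) + 2 * log 2 (real (2 * k * W)) + 2"
      using B(2)[of "\<lambda>x. real (height x)" "h - 2 * log 2 k"] by (simp only: sumW) blast
    then show ?thesis unfolding height_flat log2kW by (simp add: algebra_simps)
  qed
  define q where "q = floor_log k"
  \<comment> \<open>Balances the two kinds of cuts, each of which costs at most \<open>8 * L\<close>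
    nodes: there are at most \<open>k div L\<close> lengths divisible by \<open>L\<close>, and at
    most \<open>2 ^ L\<close> heavy heads, where \<open>2 ^ L * L\<close> is still at most
    \<open>2 * k\<close>.\<close>
  define L where "L = q div 2 + 1"
  \<comment> \<open>Now each weight is bounded below by \<open>W\<close>: the instance
    \<open>f = 0\<close>, \<open>h = - 2 log W\<close> leaves only \<open>2 log k + 4\<close>
    levels.\<close>
  have hB: "height B \<le> 8 * L"
  proof -
    have "0 \<le> - 2 * log 2 W + 2 * log 2 (real (k * w x + W))" for x
    proof -
      have "log 2 W \<le> log 2 (real (k * w x + W))"
        using W by (subst log_le_cancel_iff) (auto intro!: add_nonneg_pos)
      then show ?thesis by simp
    qed
    then have "height_with (\<lambda>_. 0) B \<le> - 2 * log 2 W + 2 * log 2 (real (2 * k * W)) + 2"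
      using B(2)[of "\<lambda>_. 0" "- 2 * log 2 W"] by (simp only: sumW) blast
    then have "real (height B) \<le> 2 * log 2 k + 4"
      unfolding height_eq_height_with log2kW by (simp add: algebra_simps)
    moreover have "log 2 k \<le> q + 1"
    proof -
      have "real k \<le> real (2 * 2 ^ q)"
        using floor_log_exp2_ge[of k] unfolding q_def of_nat_le_iff .
      then have "log 2 k \<le> log 2 (2 ^ (q + 1))"
        using k by (subst log_le_cancel_iff) auto
      then show ?thesis by (simp only: log_pow_cancel)
    qed
    ultimately have "real (height B) \<le> real (2 * q + 6)" by simp
    then have "height B \<le> 2 * q + 6" by linarith
    then show ?thesis by (simp add: L_def)
  qed
  define G where "G = (\<lambda>ys. ys \<noteq> [] \<and> (L dvd length ys \<or> W \<le> w (hd ys) * 2 ^ L))"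
  define S where "S = {ys. ys \<noteq> [] \<and> suffix ys xs}"
  define D where "D = (\<lambda>ys :: 'a btree list. flat (suffix_tree (length ys) B))"
  define T where "T = (\<lambda>ys. if G ys then D ys
    else if after_comb G ys = [] then comb G ys else Node (comb G ys) (D (after_comb G ys)))"
  obtain P where P: "\<And>m. finite (P m)" "\<And>m. card (P m) \<le> height B"
      "\<And>m. subtrees (suffix_tree m B) \<subseteq> subtrees B \<union> P m"
    using subtrees_suffix_tree[of B] by metis
  define F where "F = flat ` (subtrees B \<union> (\<Union>ys \<in> {ys \<in> S. G ys}. P (length ys))) \<union> comb G ` S \<union> T ` S"
  have finS: "finite S" and cardS: "card S = k"
    using finite_suffixes card_suffixes by (auto simp: S_def k_def)
  have cardG: "card {ys \<in> S. G ys} * (8 * L) \<le> 24 * k"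
  proof -
    let ?A = "{ys. ys \<noteq> [] \<and> suffix ys xs \<and> L dvd length ys}"
    let ?H = "{ys. ys \<noteq> [] \<and> suffix ys xs \<and> W \<le> w (hd ys) * 2 ^ L}"
    have "{ys \<in> S. G ys} = ?A \<union> ?H"
      by (auto simp: S_def G_def)
    then have "card {ys \<in> S. G ys} \<le> card ?A + card ?H"
      by (simp add: card_Un_le)
    also have "card ?A \<le> k div L"
      using card_suffixes_dvd[of L xs] by (simp add: k_def L_def)
    also have "card ?H \<le> 2 ^ L"
      using card_suffixes_heavy[of xs W w "2 ^ L"] W by (simp add: W_def[symmetric])
    finally have "card {ys \<in> S. G ys} * L \<le> (k div L + 2 ^ L) * L"
      by simp
    also have "\<dots> \<le> k + 2 ^ L * L"
      by (simp add: distrib_right)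
    also have "2 ^ L * L \<le> 2 * k"
    proof -
      have "L \<le> 2 ^ (q div 2)"
        by (simp add: L_def Suc_le_eq)
      then have "2 ^ L * L \<le> 2 ^ L * 2 ^ (q div 2)"
        by simp
      also have "\<dots> = (2 :: nat) * 2 ^ (2 * (q div 2))"
        by (simp add: L_def power_add mult_2 distrib_right)
      also have "\<dots> \<le> 2 * 2 ^ q"
        by (simp add: power_increasing)
      also have "\<dots> \<le> 2 * k"
        using floor_log_exp2_le[OF k] by (simp add: q_def)
      finally show ?thesis .
    qed
    finally show ?thesis by (simp add: mult.commute)
  qed
  \<comment> \<open>28 = 2 for the subtrees of \<open>B\<close>, 24 for the cuts, 1 for the combs
    and 1 for the roots \<open>T ys\<close>.\<close>
  have "card F \<le> 28 * k"
  proof -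
    have "card (subtrees B) \<le> 2 * k"
      using card_subtrees_le[of B] by (simp add: B k_def)
    moreover have "card (\<Union>ys \<in> {ys \<in> S. G ys}. P (length ys)) \<le> 24 * k"
    proof -
      have "card (\<Union>ys \<in> {ys \<in> S. G ys}. P (length ys)) \<le> (\<Sum>ys \<in> {ys \<in> S. G ys}. card (P (length ys)))"
        using finS by (intro card_UN_le) auto
      also have "\<dots> \<le> card {ys \<in> S. G ys} * (8 * L)"
        using P(2) hB by (intro sum_bounded_above[of _ _ "8 * L", simplified]) (auto intro: order_trans)
      finally show ?thesis using cardG by (rule order_trans)
    qed
    moreover have "card (comb G ` S) \<le> k" "card (T ` S) \<le> k"
      using card_image_le[OF finS] by (auto simp: cardS)
    moreover have "card F \<le> card (subtrees B) + card (\<Union>ys \<in> {ys \<in> S. G ys}. P (length ys))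
        + card (comb G ` S) + card (T ` S)"
      unfolding F_def using finS P(1)
      by (intro card_Un_le[THEN order_trans] add_mono order_refl card_image_le[THEN order_trans]) auto
    ultimately show ?thesis by linarith
  qed
  moreover have "finite F"
    using finS P(1) by (auto simp: F_def)
  moreover have "frontier (T ys) = concat (map frontier ys) \<and> subtrees (T ys) \<subseteq> F \<union> \<Union> (subtrees ` set xs) \<and>
       (\<forall>h. (\<forall>x \<in> set xs. real (height x) \<le> h + 2 * log 2 (length (frontier x))) \<longrightarrow>
          real (height (T ys)) \<le> h + 2 * log 2 (length (concat (map frontier xs))) + 5)"
    if ys: "ys \<noteq> []" "suffix ys xs" for ys
  proof (intro conjI allI impI)
    have frD: "frontier (D zs) = concat (map frontier zs)" if "zs \<noteq> []" "suffix zs xs" for zs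
    proof -
      have "frontier (suffix_tree (length zs) B) = zs"
        using that suffix_length_le[OF that(2)] by (subst frontier_suffix_tree) (auto simp: B suffix_def)
      then show ?thesis by (simp add: D_def frontier_flat)
    qed
    have after_comb: "suffix (after_comb G ys) xs"
      using suffix_after_comb ys(2) by (rule suffix_order.trans)
    show "frontier (T ys) = concat (map frontier ys)"
      using frD[OF ys] frD[OF _ after_comb] frontier_comb[OF ys(1), of G] by (auto simp: T_def)
    have subsD: "subtrees (D zs) \<subseteq> F \<union> \<Union> (subtrees ` set xs)" if "zs \<in> S" "G zs" for zs
    proof -
      have zs: "zs \<noteq> []" "suffix zs xs" using that by (auto simp: S_def)
      have "frontier (suffix_tree (length zs) B) = zs"
        using zs suffix_length_le[OF zs(2)] by (subst frontier_suffix_tree) (auto simp: B suffix_def)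
      then have "subtrees (D zs) \<subseteq> flat ` subtrees (suffix_tree (length zs) B) \<union> \<Union> (subtrees ` set zs)"
        using subtrees_flat[of "suffix_tree (length zs) B"] by (simp add: D_def)
      moreover have "flat ` subtrees (suffix_tree (length zs) B) \<subseteq> F"
        using P(3)[of "length zs"] that by (fastforce simp: F_def)
      moreover have "\<Union> (subtrees ` set zs) \<subseteq> \<Union> (subtrees ` set xs)"
        using set_mono_suffix[OF zs(2)] by auto
      ultimately show ?thesis by (meson Un_mono order_trans)
    qed
    have subsC: "subtrees (comb G ys) \<subseteq> F \<union> \<Union> (subtrees ` set xs)"
    proof -
      have "{zs. zs \<noteq> [] \<and> suffix zs ys} \<subseteq> S"
        using ys by (auto simp: S_def intro: suffix_order.trans)
      then have "comb G ` {zs. zs \<noteq> [] \<and> suffix zs ys} \<subseteq> F"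
        by (auto simp: F_def)
      moreover have "\<Union> (subtrees ` set ys) \<subseteq> \<Union> (subtrees ` set xs)"
        using set_mono_suffix[OF ys(2)] by auto
      ultimately show ?thesis
        using subtrees_comb[OF ys(1), of G] by (meson Un_mono order_trans)
    qed
    have "T ys \<in> F" using ys by (auto simp: F_def S_def)
    consider "G ys" | "\<not> G ys" "after_comb G ys = []" | "\<not> G ys" "after_comb G ys \<noteq> []" "G (after_comb G ys)"
      using after_comb_stops[of G ys] by blast
    then show "subtrees (T ys) \<subseteq> F \<union> \<Union> (subtrees ` set xs)"
    proof cases
      case 1
      then show ?thesis using subsD[of ys] ys by (simp add: T_def S_def)
    next
      case 2
      then show ?thesis using subsC by (simp add: T_def)
    next
      case 3
      have "subtrees (T ys) = insert (T ys) (subtrees (comb G ys) \<union> subtrees (D (after_comb G ys)))"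
        using 3 by (simp add: T_def)
      moreover have "subtrees (D (after_comb G ys)) \<subseteq> F \<union> \<Union> (subtrees ` set xs)"
        using 3 after_comb by (intro subsD) (auto simp: S_def)
      ultimately show ?thesis using subsC \<open>T ys \<in> F\<close> by simp
    qed
    fix h
    assume h: "\<forall>x \<in> set xs. real (height x) \<le> h + 2 * log 2 (length (frontier x))"
    have hgtD: "real (height (D zs)) \<le> h + 2 * log 2 W + 4" for zs
      unfolding D_def height_flat
      using height_with_suffix_tree[of "\<lambda>x. real (height x)" "length zs" B] flatB[of h] h
      by (simp add: height_flat w_def)
    \<comment> \<open>The trees of the comb weigh less than \<open>W / 2 ^ L\<close>, which lowers
      their height bound by \<open>2 * L\<close>; this absorbs the depth of the comb, which is below
      \<open>L\<close>.\<close>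
    have hgtC: "real (height (comb G ys)) \<le> h + 2 * log 2 W" if "\<not> G ys"
    proof -
      have "real (height (comb G ys)) \<le> (h + 2 * (log 2 W - L)) + real (length ys mod L)"
      proof (rule height_comb[of ys G L, OF ys(1) that])
        fix zs assume zs: "suffix zs ys"
        show "zs = [] \<or> G zs" if "L dvd length zs"
          using that by (auto simp: G_def)
        assume *: "zs \<noteq> []" "\<not> G zs"
        then have "w (hd zs) * 2 ^ L < W" by (auto simp: G_def)
        then have "real (w (hd zs) * 2 ^ L) \<le> real W" by (simp only: of_nat_le_iff)
        then have "log 2 (real (w (hd zs) * 2 ^ L)) \<le> log 2 W"
          using W wpos[of "hd zs"] by (subst log_le_cancel_iff) auto
        moreover have "log 2 (real (w (hd zs) * 2 ^ L)) = log 2 (w (hd zs)) + L"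
          using wpos[of "hd zs"] by (simp add: log_mult log_nat_power)
        moreover have "hd zs \<in> set xs"
          using * zs ys(2) by (meson hd_in_set set_mono_suffix subsetD)
        ultimately show "real (height (hd zs)) \<le> h + 2 * (log 2 W - L)"
          using h by (fastforce simp: w_def)
      qed
      moreover have "length ys mod L \<le> L"
        by (rule less_imp_le, rule mod_less_divisor) (simp add: L_def)
      then have "real (length ys mod L) \<le> 2 * L"
        by linarith
      ultimately show ?thesis by (simp add: algebra_simps)
    qed
    show "real (height (T ys)) \<le> h + 2 * log 2 (length (concat (map frontier xs))) + 5"
      using hgtD[of ys] hgtD[of "after_comb G ys"] hgtC
      by (auto simp: T_def W_concat[symmetric] split: if_splits)
  qed
  ultimately show ?thesis unfolding k_def by blast
qed

text \<open>The mirror image of \<open>suffix_trees\<close>, for siblings on the right of a path.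
  Listed from the top, they appear in reverse order in the string, so a suffix of the list is a
  prefix of what stands there.\<close>

lemma prefix_trees:
  fixes xs :: "'a btree list"
  shows "\<exists>T F. finite F \<and> card F \<le> 28 * length xs \<and>
    (\<forall>ys. ys \<noteq> [] \<and> suffix ys xs \<longrightarrow>
       frontier (T ys) = concat (map frontier (rev ys)) \<and> subtrees (T ys) \<subseteq> F \<union> \<Union> (subtrees ` set xs) \<and>
       (\<forall>h. (\<forall>x \<in> set xs. real (height x) \<le> h + 2 * log 2 (length (frontier x))) \<longrightarrow>
          real (height (T ys)) \<le> h + 2 * log 2 (length (concat (map frontier xs))) + 5))"
proof -
  from suffix_trees[of "map mirror xs"] obtain T F where
    TF: "finite F" "card F \<le> 28 * length (map mirror xs)"
    and T: "\<forall>ys. ys \<noteq> [] \<and> suffix ys (map mirror xs) \<longrightarrow>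
      frontier (T ys) = concat (map frontier ys) \<and> subtrees (T ys) \<subseteq> F \<union> \<Union> (subtrees ` set (map mirror xs)) \<and>
       (\<forall>h. (\<forall>x \<in> set (map mirror xs). real (height x) \<le> h + 2 * log 2 (length (frontier x))) \<longrightarrow>
          real (height (T ys)) \<le> h + 2 * log 2 (length (concat (map frontier (map mirror xs)))) + 5)"
    by (elim exE conjE)
  have len: "length (concat (map (\<lambda>x. rev (frontier x)) xs)) = length (concat (map frontier xs))"
    by (induction xs) auto
  have rc: "rev (concat (map (\<lambda>x. rev (frontier x)) ys)) = concat (map frontier (rev ys))" for ys :: "'a btree list"
    by (induction ys) auto
  show ?thesis
  proof (intro exI[of _ "\<lambda>ys. mirror (T (map mirror ys))"] exI[of _ "mirror ` F"] conjI allI impI, goal_cases)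
    case 1
    then show ?case using TF by simp
  next
    case 2
    then show ?case using TF(2) card_image_le[OF TF(1), of mirror] by (simp only: length_map)
  next
    case (3 ys)
    then have "suffix (map mirror ys) (map mirror xs)" by (simp add: map_mono_suffix)
    then show ?case using T[rule_format, of "map mirror ys"] 3 by (simp add: comp_def rc)
  next
    case (4 ys)
    then have "suffix (map mirror ys) (map mirror xs)" by (simp add: map_mono_suffix)
    then have "mirror ` subtrees (T (map mirror ys)) \<subseteq> mirror ` (F \<union> \<Union> (subtrees ` set (map mirror xs)))"
      using T[rule_format, of "map mirror ys"] 4 by (intro image_mono) auto
    also have "\<dots> \<subseteq> mirror ` F \<union> \<Union> (subtrees ` set xs)"
      by (auto simp: subtrees_mirror)
    finally show ?case by (simp add: subtrees_mirror)
  next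
    case (5 ys h)
    then have "suffix (map mirror ys) (map mirror xs)" by (simp add: map_mono_suffix)
    then show ?case using T[rule_format, of "map mirror ys"] 5 by (simp add: comp_def len)
  qed
qed

section \<open>Symmetric centroid paths\<close>

text \<open>In the graph of distinct subtrees this is the number of paths from the root
  \<open>t\<close> to \<open>v\<close>.\<close>

fun occurrences :: "'a btree \<Rightarrow> 'a btree \<Rightarrow> nat" where
  "occurrences v (Leaf a) = of_bool (v = Leaf a)"
| "occurrences v (Node l r) = of_bool (v = Node l r) + occurrences v l + occurrences v r"

lemma occurrences_eq_0: "length (frontier t) < length (frontier v) \<Longrightarrow> occurrences v t = 0"
  by (induction t) auto

lemma occurrences_le: "occurrences v t \<le> length (frontier t)"
proof (induction t)
  case (Node l r)
  show ?case
  proof (cases "v = Node l r")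
    case True
    then have "occurrences v l = 0" "occurrences v r = 0" by (auto intro!: occurrences_eq_0)
    with True show ?thesis by (simp add: Suc_le_eq)
  next
    case False
    with Node show ?thesis by simp
  qed
qed (auto simp: of_bool_def)

lemma occurrences_pos: "v \<in> subtrees t \<Longrightarrow> 0 < occurrences v t"
  by (induction t) auto

lemma occurrences_self: "occurrences t t = 1"
proof (cases t)
  case (Node l r)
  then have "occurrences t l = 0" "occurrences t r = 0" by (auto intro!: occurrences_eq_0)
  with Node show ?thesis by simp
qed auto

definition child :: "'a btree \<Rightarrow> 'a btree \<Rightarrow> bool" where
  "child u v \<longleftrightarrow> (\<exists>x. u = Node v x \<or> u = Node x v)"

text \<open>Every occurrence of \<open>u\<close> has an occurrence of \<open>v\<close> below it. An
  occurrence of \<open>v\<close> at the root has no parent; counting it separately lets the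
  induction pass from the two subtrees to their parent.\<close>

lemma occurrences_child: "child u v \<Longrightarrow> occurrences u t + of_bool (v = t) \<le> occurrences v t"
proof (induction t)
  case (Node l r)
  have "of_bool (u = Node l r) \<le> (of_bool (v = l) + of_bool (v = r) :: nat)"
    using Node.prems by (auto simp: child_def)
  with Node show ?case by simp
qed (auto simp: child_def)

text \<open>Occurrences of \<open>v\<close> below different parents are different.\<close>

lemma occurrences_children:
  "child u v \<Longrightarrow> child u' v \<Longrightarrow> u \<noteq> u' \<Longrightarrow> occurrences u t + occurrences u' t + of_bool (v = t) \<le> occurrences v t"
proof (induction t)
  case (Node l r)
  have "of_bool (u = Node l r) + of_bool (u' = Node l r) \<le> (of_bool (v = l) + of_bool (v = r) :: nat)"
    using Node.prems by (auto simp: child_def)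
  with Node show ?case by simp
qed (auto simp: child_def)

text \<open>Applied to leaf counts it excludes two children of the rank of their parent, applied to
  occurrences it excludes two parents of the rank of their child.\<close>

lemma floor_log_add_gt:
  assumes "0 < a" "floor_log a = k" "floor_log b = k" "0 < b"
  shows "k < floor_log (a + b)"
proof -
  have "2 ^ k \<le> a" "2 ^ k \<le> b"
    using assms floor_log_exp2_le by metis+
  then have "2 ^ Suc k \<le> a + b" by simp
  then have "floor_log (2 ^ Suc k) \<le> floor_log (a + b)" by (rule floor_log_le_iff)
  then show ?thesis by (simp only: floor_log_power)
qed

context
  fixes t :: "'a btree"
begin

text \<open>The occurrences enter through their distance from the largest possible value, so by
  \<open>occurrences_le\<close> the subtraction does not truncate.\<close>

definition rank :: "'a btree \<Rightarrow> nat" where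
  "rank u = floor_log (length (frontier u)) + (floor_log (length (frontier t)) - floor_log (occurrences u t))"

text \<open>Neither summand of the rank increases towards a child, so equal ranks force both
  summands to agree.\<close>

lemma rank_child:
  assumes "child u v"
  shows "rank v \<le> rank u"
    and "u \<in> subtrees t \<Longrightarrow> rank v = rank u \<Longrightarrow>
      floor_log (length (frontier v)) = floor_log (length (frontier u)) \<and> floor_log (occurrences v t) = floor_log (occurrences u t)"
proof -
  have 1: "floor_log (length (frontier v)) \<le> floor_log (length (frontier u))"
    using assms by (intro floor_log_le_iff) (auto simp: child_def)
  have 2: "floor_log (occurrences u t) \<le> floor_log (occurrences v t)"
    using occurrences_child[OF assms, of t] by (intro floor_log_le_iff) auto
  have 3: "floor_log (occurrences v t) \<le> floor_log (length (frontier t))"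
    by (intro floor_log_le_iff occurrences_le)
  show "rank v \<le> rank u"
    using 1 2 3 by (simp add: rank_def)
  show "floor_log (length (frontier v)) = floor_log (length (frontier u)) \<and> floor_log (occurrences v t) = floor_log (occurrences u t)"
    if "rank v = rank u"
    using 1 2 3 that unfolding rank_def by linarith
qed

lemma rank_children:
  assumes "Node x y \<in> subtrees t"
  shows "rank x \<le> rank (Node x y)" "rank y \<le> rank (Node x y)" "rank x < rank (Node x y) \<or> rank y < rank (Node x y)"
proof -
  have c: "child (Node x y) x" "child (Node x y) y" by (auto simp: child_def)
  show le: "rank x \<le> rank (Node x y)" "rank y \<le> rank (Node x y)"
    using c by (auto intro: rank_child)
  show "rank x < rank (Node x y) \<or> rank y < rank (Node x y)"
  proof (rule ccontr)
    assume "\<not> ?thesis"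
    with le have "rank x = rank (Node x y)" "rank y = rank (Node x y)" by auto
    with rank_child(2)[OF c(1) assms] rank_child(2)[OF c(2) assms]
    show False
      using floor_log_add_gt[of "length (frontier x)" _ "length (frontier y)"] by auto
  qed
qed

lemma rank_parent:
  assumes "child u v" "child u' v" "u \<in> subtrees t" "u' \<in> subtrees t" "rank v = rank u" "rank v = rank u'"
  shows "u = u'"
proof (rule ccontr)
  assume "u \<noteq> u'"
  from occurrences_children[OF assms(1,2) this, of t] have "occurrences u t + occurrences u' t \<le> occurrences v t" by simp
  then have "floor_log (occurrences u t + occurrences u' t) \<le> floor_log (occurrences v t)" by (rule floor_log_le_iff)
  moreover have "floor_log (occurrences v t) = floor_log (occurrences u t)" "floor_log (occurrences v t) = floor_log (occurrences u' t)"
    using assms rank_child(2) by blast+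
  ultimately show False
    using floor_log_add_gt[of "occurrences u t" _ "occurrences u' t"] occurrences_pos[OF assms(3)] occurrences_pos[OF assms(4)] by simp
qed

section \<open>The paths of equal rank and the subtrees hanging off them\<close>

definition heavy :: "('a btree \<times> 'a btree) set" where
  "heavy = {(u, v). u \<in> subtrees t \<and> child u v \<and> rank v = rank u}"

definition heavy_chain :: "'a btree \<Rightarrow> 'a btree set" where
  "heavy_chain u = heavy\<^sup>* `` {u}"

text \<open>Listed from the top of the path, so that a node further down has a suffix of the
  list.\<close>

fun left_siblings :: "'a btree \<Rightarrow> 'a btree list" where
  "left_siblings (Leaf a) = []"
| "left_siblings (Node x y) = (if rank x = rank (Node x y) then left_siblings x
     else if rank y = rank (Node x y) then x # left_siblings y else [])"

fun right_siblings :: "'a btree \<Rightarrow> 'a btree list" where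
  "right_siblings (Leaf a) = []"
| "right_siblings (Node x y) = (if rank x = rank (Node x y) then y # right_siblings x
     else if rank y = rank (Node x y) then right_siblings y else [])"

fun chain_end :: "'a btree \<Rightarrow> 'a btree" where
  "chain_end (Leaf a) = Leaf a"
| "chain_end (Node x y) = (if rank x = rank (Node x y) then chain_end x
     else if rank y = rank (Node x y) then chain_end y else Node x y)"

lemma frontier_chain: "frontier u = concat (map frontier (left_siblings u)) @ frontier (chain_end u) @ concat (map frontier (rev (right_siblings u)))"
  by (induction u) auto

lemma sib_light:
  "u \<in> subtrees t \<Longrightarrow> y \<in> set (left_siblings u) \<union> set (right_siblings u) \<Longrightarrow> y \<in> subtrees t \<and> rank y < rank u"
proof (induction u)
  case (Node l r)
  then show ?case
    using rank_children[OF Node.prems(1)] subtrees_Node_in[OF Node.prems(1)] by (auto split: if_splits)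
qed auto

lemma chain_end_cases:
  "u \<in> subtrees t \<Longrightarrow> (\<exists>a. chain_end u = Leaf a) \<or>
    (\<exists>x y. chain_end u = Node x y \<and> x \<in> subtrees t \<and> y \<in> subtrees t \<and> rank x < rank u \<and> rank y < rank u)"
proof (induction u)
  case (Node l r)
  then show ?case
    using rank_children[OF Node.prems(1)] subtrees_Node_in[OF Node.prems(1)] by (auto split: if_splits)
qed auto

lemma heavyD:
  assumes "(u, v) \<in> heavy"
  shows "u \<in> subtrees t" "v \<in> subtrees t" "rank v = rank u" "chain_end v = chain_end u"
    "suffix (left_siblings v) (left_siblings u)" "suffix (right_siblings v) (right_siblings u)"
    "floor_log (length (frontier v)) = floor_log (length (frontier u))" "length (frontier v) < length (frontier u)"
proof -
  from assms have u: "u \<in> subtrees t" and c: "child u v" and r: "rank v = rank u"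
    by (auto simp: heavy_def)
  from c obtain x where x: "u = Node v x \<or> u = Node x v" by (auto simp: child_def)
  show "u \<in> subtrees t" "rank v = rank u" using u r by auto
  show "v \<in> subtrees t" using u x subtrees_Node_in by blast
  show "floor_log (length (frontier v)) = floor_log (length (frontier u))"
    using rank_child(2)[OF c u r] by simp
  show "length (frontier v) < length (frontier u)" using x by auto
  show "chain_end v = chain_end u" "suffix (left_siblings v) (left_siblings u)" "suffix (right_siblings v) (right_siblings u)"
    using x r u rank_children(3)[of v x] rank_children(3)[of x v] by (auto intro: suffix_ConsI)
qed

lemma chnD:
  assumes "v \<in> heavy_chain u" "u \<in> subtrees t"
  shows "v \<in> subtrees t \<and> rank v = rank u \<and> chain_end v = chain_end u \<and> suffix (left_siblings v) (left_siblings u) \<and>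
    suffix (right_siblings v) (right_siblings u) \<and> floor_log (length (frontier v)) = floor_log (length (frontier u))"
proof -
  from assms(1) have "(u, v) \<in> heavy\<^sup>*" by (simp add: heavy_chain_def)
  then show ?thesis
  proof (induction rule: rtrancl_induct)
    case (step v v')
    with heavyD[OF step(2)] show ?case by (auto intro: suffix_order.trans)
  qed (use assms(2) in auto)
qed

lemma heavy_chain_length: "v \<in> heavy_chain u \<Longrightarrow> length (frontier v) \<le> length (frontier u)"
  unfolding heavy_chain_def
  by (auto elim!: rtrancl_induct dest: heavyD(8))

lemma finite_heavy_chain: "u \<in> subtrees t \<Longrightarrow> finite (heavy_chain u)"
  by (rule finite_subset[of _ "subtrees t"]) (auto dest: chnD)

lemma heavy_chain_step: "(u, v) \<in> heavy \<Longrightarrow> insert u (heavy_chain v) \<subseteq> heavy_chain u \<and> u \<notin> heavy_chain v"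
  using heavyD(8) heavy_chain_length by (fastforce simp: heavy_chain_def intro: converse_rtrancl_into_rtrancl)

lemma card_heavy_chain_step:
  assumes "(u, v) \<in> heavy"
  shows "Suc (card (heavy_chain v)) \<le> card (heavy_chain u)"
proof -
  have "card (insert u (heavy_chain v)) \<le> card (heavy_chain u)"
    using heavy_chain_step[OF assms] heavyD(1)[OF assms] by (intro card_mono finite_heavy_chain) auto
  then show ?thesis
    using heavy_chain_step[OF assms] finite_heavy_chain[OF heavyD(2)[OF assms]] by simp
qed

text \<open>Each sibling belongs to one edge of the path, and a path has fewer edges than nodes.
  Thus costs per sibling can be charged to the nodes of the path.\<close>

lemma length_sib_less: "u \<in> subtrees t \<Longrightarrow> length (left_siblings u) + length (right_siblings u) < card (heavy_chain u)"
proof (induction u)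
  case (Leaf a)
  have "Leaf a \<in> heavy_chain (Leaf a)" by (simp add: heavy_chain_def)
  then show ?case using finite_heavy_chain[OF Leaf] by (auto simp: card_gt_0_iff)
next
  case (Node x y)
  have pos: "0 < card (heavy_chain (Node x y))"
    using finite_heavy_chain[OF Node.prems] by (auto simp: card_gt_0_iff heavy_chain_def)
  consider "rank x = rank (Node x y)" | "rank x \<noteq> rank (Node x y)" "rank y = rank (Node x y)"
    | "rank x \<noteq> rank (Node x y)" "rank y \<noteq> rank (Node x y)" by blast
  then show ?case
  proof cases
    case 1
    then have "(Node x y, x) \<in> heavy" using Node.prems by (auto simp: heavy_def child_def)
    from card_heavy_chain_step[OF this] 1 Node.IH(1) subtrees_Node_in(1)[OF Node.prems] show ?thesis by simp
  next
    case 2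
    then have "(Node x y, y) \<in> heavy" using Node.prems by (auto simp: heavy_def child_def)
    from card_heavy_chain_step[OF this] 2 Node.IH(2) subtrees_Node_in(2)[OF Node.prems] show ?thesis by simp
  next
    case 3
    with pos show ?thesis by simp
  qed
qed

text \<open>Climbing along heavy edges lengthens the frontier, which cannot exceed that of
  \<open>t\<close>.\<close>

lemma ex_top: "u \<in> subtrees t \<Longrightarrow> \<exists>v \<in> subtrees t. u \<in> heavy_chain v \<and> (\<forall>x. (x, v) \<notin> heavy)"
proof (induction "length (frontier t) - length (frontier u)" arbitrary: u rule: less_induct)
  case less
  show ?case
  proof (cases "\<exists>x. (x, u) \<in> heavy")
    case True
    then obtain x where x: "(x, u) \<in> heavy" by blast
    from heavyD[OF this] length_frontier_subtrees[of x t] have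
      "length (frontier t) - length (frontier x) < length (frontier t) - length (frontier u)" "x \<in> subtrees t" by auto
    from less(1)[OF this] obtain v where "v \<in> subtrees t" "x \<in> heavy_chain v" "\<forall>x. (x, v) \<notin> heavy" by blast
    with x show ?thesis by (auto simp: heavy_chain_def intro: rtrancl_into_rtrancl)
  next
    case False
    with less.prems show ?thesis by (auto simp: heavy_chain_def)
  qed
qed

text \<open>By \<open>rank_parent\<close> heavy edges are a partial function upwards. Two nodes
  reached from \<open>u\<close> by climbing are therefore comparable, and they coincide if neither
  can be climbed from.\<close>

lemma top_unique:
  assumes "u \<in> heavy_chain v" "u \<in> heavy_chain v'" "\<forall>x. (x, v) \<notin> heavy" "\<forall>x. (x, v') \<notin> heavy"
  shows "v = v'"
proof -
  have "single_valued (heavy\<inverse>)"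
    by (auto simp: single_valued_def heavy_def intro: rank_parent)
  moreover have "(u, v) \<in> (heavy\<inverse>)\<^sup>*" "(u, v') \<in> (heavy\<inverse>)\<^sup>*"
    using assms(1,2) by (auto simp: heavy_chain_def rtrancl_converse)
  ultimately have "(v, v') \<in> (heavy\<inverse>)\<^sup>* \<or> (v', v) \<in> (heavy\<inverse>)\<^sup>*"
    by (rule single_valued_confluent)
  then show ?thesis
    using assms(3,4) by (auto elim: converse_rtranclE)
qed

text \<open>The string of a node on the path consists of a suffix of the left siblings, the string
  of the end of the path, and a prefix of the right siblings. The outer parts come from the shared
  trees, so a node on the path needs only two nodes of its own to join the three parts.
  \<open>N\<close> supplies the trees already rebuilt for smaller ranks.\<close>

lemma chain_trees:
  fixes N :: "'a btree \<Rightarrow> 'a btree" and h :: real and v :: "'a btree"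
  defines "R \<equiv> \<Union> (subtrees ` N ` {y \<in> subtrees t. rank y < rank v})"
  assumes v: "v \<in> subtrees t" and h: "0 \<le> h"
    and N: "\<And>y. y \<in> subtrees t \<Longrightarrow> rank y < rank v \<Longrightarrow>
      frontier (N y) = frontier y \<and> real (height (N y)) \<le> h + 2 * log 2 (length (frontier y))"
  shows "\<exists>M F. finite F \<and> card F \<le> 31 * card (heavy_chain v) \<and>
    (\<forall>u \<in> heavy_chain v. frontier (M u) = frontier u \<and> subtrees (M u) \<subseteq> F \<union> R \<and>
       real (height (M u)) \<le> h + 10 + 2 * log 2 (length (frontier u)))"
proof -
  define n where "n = length (frontier v)"
  have n: "0 < n" by (simp add: n_def)
  have sibs: "frontier (N y) = frontier y" "real (height (N y)) \<le> h + 2 * log 2 (length (frontier (N y)))"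
    "subtrees (N y) \<subseteq> R" if "y \<in> set (left_siblings v) \<union> set (right_siblings v)" for y
    using sib_light[OF v that] N[of y] by (auto simp: R_def)
  have cat: "concat (map frontier (map N ys)) = concat (map frontier ys)"
    if "set ys \<subseteq> set (left_siblings v) \<union> set (right_siblings v)" for ys
    using that sibs(1) by (induction ys) auto
  have len: "length (frontier v) = length (concat (map frontier (left_siblings v))) + length (frontier (chain_end v))
      + length (concat (map frontier (right_siblings v)))"
    by (subst frontier_chain) (simp add: length_concat rev_map[symmetric] sum_list_rev)
  \<comment> \<open>Covers a side without siblings as well: the logarithm of 0 is 0.\<close>
  have logn: "log 2 (length zs) \<le> log 2 n" if "length zs \<le> n" for zs :: "'a list"
  proof (cases "zs = []")
    case True
    then show ?thesis using n by (simp add: log_def)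
  next
    case False
    then show ?thesis using n that by simp
  qed
  from suffix_trees[of "map N (left_siblings v)"] obtain TL FL where
    FL: "finite FL" "card FL \<le> 28 * length (map N (left_siblings v))"
    and TL: "\<forall>ys. ys \<noteq> [] \<and> suffix ys (map N (left_siblings v)) \<longrightarrow>
       frontier (TL ys) = concat (map frontier ys) \<and> subtrees (TL ys) \<subseteq> FL \<union> \<Union> (subtrees ` set (map N (left_siblings v))) \<and>
       (\<forall>h. (\<forall>x \<in> set (map N (left_siblings v)). real (height x) \<le> h + 2 * log 2 (length (frontier x))) \<longrightarrow>
          real (height (TL ys)) \<le> h + 2 * log 2 (length (concat (map frontier (map N (left_siblings v))))) + 5)"
    by (elim exE conjE)
  from prefix_trees[of "map N (right_siblings v)"] obtain TR FR where
    FR: "finite FR" "card FR \<le> 28 * length (map N (right_siblings v))"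
    and TR: "\<forall>ys. ys \<noteq> [] \<and> suffix ys (map N (right_siblings v)) \<longrightarrow>
       frontier (TR ys) = concat (map frontier (rev ys)) \<and> subtrees (TR ys) \<subseteq> FR \<union> \<Union> (subtrees ` set (map N (right_siblings v))) \<and>
       (\<forall>h. (\<forall>x \<in> set (map N (right_siblings v)). real (height x) \<le> h + 2 * log 2 (length (frontier x))) \<longrightarrow>
          real (height (TR ys)) \<le> h + 2 * log 2 (length (concat (map frontier (map N (right_siblings v))))) + 5)"
    by (elim exE conjE)
  have L: "frontier (TL (map N ys)) = concat (map frontier ys) \<and> subtrees (TL (map N ys)) \<subseteq> FL \<union> R \<and>
      real (height (TL (map N ys))) \<le> h + 2 * log 2 n + 5"
    if ys: "ys \<noteq> []" "suffix ys (left_siblings v)" for ys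
  proof -
    have ys': "set ys \<subseteq> set (left_siblings v)" using ys(2) by (rule set_mono_suffix)
    have 1: "\<Union> (subtrees ` set (map N (left_siblings v))) \<subseteq> R" using sibs(3) by auto
    have 2: "\<forall>x \<in> set (map N (left_siblings v)). real (height x) \<le> h + 2 * log 2 (length (frontier x))"
      using sibs(2) by auto
    have "length (concat (map frontier (left_siblings v))) \<le> n" using len by (simp add: n_def)
    then have 3: "log 2 (length (concat (map frontier (map N (left_siblings v))))) \<le> log 2 n"
      using cat[of "left_siblings v"] logn by simp
    from TL[rule_format, of "map N ys"] ys have
      "frontier (TL (map N ys)) = concat (map frontier (map N ys))"
      "subtrees (TL (map N ys)) \<subseteq> FL \<union> \<Union> (subtrees ` set (map N (left_siblings v)))"
      "real (height (TL (map N ys))) \<le> h + 2 * log 2 (length (concat (map frontier (map N (left_siblings v))))) + 5"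
      using 2 by (auto simp: map_mono_suffix)
    moreover have "concat (map frontier (map N (ys))) = concat (map frontier (ys))"
      using ys' by (intro cat) auto
    ultimately show ?thesis using 1 3 by (simp del: map_map) blast
  qed
  have R': "frontier (TR (map N ys)) = concat (map frontier (rev ys)) \<and> subtrees (TR (map N ys)) \<subseteq> FR \<union> R \<and>
      real (height (TR (map N ys))) \<le> h + 2 * log 2 n + 5"
    if ys: "ys \<noteq> []" "suffix ys (right_siblings v)" for ys
  proof -
    have ys': "set ys \<subseteq> set (right_siblings v)" using ys(2) by (rule set_mono_suffix)
    have 1: "\<Union> (subtrees ` set (map N (right_siblings v))) \<subseteq> R" using sibs(3) by auto
    have 2: "\<forall>x \<in> set (map N (right_siblings v)). real (height x) \<le> h + 2 * log 2 (length (frontier x))"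
      using sibs(2) by auto
    have "length (concat (map frontier (right_siblings v))) \<le> n" using len by (simp add: n_def)
    then have 3: "log 2 (length (concat (map frontier (map N (right_siblings v))))) \<le> log 2 n"
      using cat[of "right_siblings v"] logn by simp
    from TR[rule_format, of "map N ys"] ys have
      "frontier (TR (map N ys)) = concat (map frontier (map N (rev ys)))"
      "subtrees (TR (map N ys)) \<subseteq> FR \<union> \<Union> (subtrees ` set (map N (right_siblings v)))"
      "real (height (TR (map N ys))) \<le> h + 2 * log 2 (length (concat (map frontier (map N (right_siblings v))))) + 5"
      using 2 by (auto simp: map_mono_suffix rev_map)
    moreover have "concat (map frontier (map N (rev ys))) = concat (map frontier (rev ys))"
      using ys' by (intro cat) auto
    ultimately show ?thesis using 1 3 by (simp del: map_map) blast
  qed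
  \<comment> \<open>The path ends in a leaf or in a node both of whose children have smaller rank
    and are already rebuilt.\<close>
  define Z where "Z = (case chain_end v of Leaf a \<Rightarrow> Leaf a | Node x y \<Rightarrow> Node (N x) (N y))"
  have Z: "frontier Z = frontier (chain_end v) \<and> subtrees Z \<subseteq> insert Z R \<and> real (height Z) \<le> h + 2 * log 2 n + 1"
    using chain_end_cases[OF v]
  proof (elim disjE exE conjE)
    fix a assume "chain_end v = Leaf a"
    moreover have "0 \<le> log 2 n" using n by simp
    ultimately show ?thesis using h by (auto simp: Z_def)
  next
    fix x y assume *: "chain_end v = Node x y" "x \<in> subtrees t" "y \<in> subtrees t" "rank x < rank v" "rank y < rank v"
    have "length (frontier x) \<le> n" "length (frontier y) \<le> n"
      using * len by (simp_all add: n_def)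
    then have "log 2 (length (frontier x)) \<le> log 2 n" "log 2 (length (frontier y)) \<le> log 2 n"
      using logn by blast+
    with * N[of x] N[of y] show ?thesis by (auto simp: Z_def R_def)
  qed
  define MR where "MR = (\<lambda>u. if right_siblings u = [] then Z else Node Z (TR (map N (right_siblings u))))"
  define M where "M = (\<lambda>u. if left_siblings u = [] then MR u else Node (TL (map N (left_siblings u))) (MR u))"
  define F where "F = insert Z (FL \<union> FR \<union> MR ` heavy_chain v \<union> M ` heavy_chain v)"
  have fin: "finite (heavy_chain v)" using v by (rule finite_heavy_chain)
  have "finite F" using FL(1) FR(1) fin by (simp add: F_def)
  \<comment> \<open>28 new nodes for each sibling, one for \<open>Z\<close> and two for each node of
    the path, where the siblings are fewer than the nodes.\<close>
  moreover have "card F \<le> 31 * card (heavy_chain v)"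
  proof -
    have "card F \<le> Suc (card (FL \<union> FR \<union> MR ` heavy_chain v \<union> M ` heavy_chain v))"
      unfolding F_def by (rule card_insert_le_m1) auto
    also have "card (FL \<union> FR \<union> MR ` heavy_chain v \<union> M ` heavy_chain v) \<le>
        card FL + card FR + card (MR ` heavy_chain v) + card (M ` heavy_chain v)"
      by (intro card_Un_le[THEN order_trans] add_mono order_refl)
    also have "\<dots> \<le> card FL + card FR + card (heavy_chain v) + card (heavy_chain v)"
      by (intro add_mono order_refl card_image_le fin)
    finally show ?thesis
      using FL(2) FR(2) length_sib_less[OF v] by simp
  qed
  moreover have "frontier (M u) = frontier u \<and> subtrees (M u) \<subseteq> F \<union> R \<and>
       real (height (M u)) \<le> h + 10 + 2 * log 2 (length (frontier u))" if u: "u \<in> heavy_chain v" for u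
  proof -
    from chnD[OF u v] have u': "chain_end u = chain_end v" "suffix (left_siblings u) (left_siblings v)" "suffix (right_siblings u) (right_siblings v)"
      "floor_log (length (frontier u)) = floor_log n" by (auto simp: n_def)
    have MR: "frontier (MR u) = frontier (chain_end v) @ concat (map frontier (rev (right_siblings u)))" "subtrees (MR u) \<subseteq> F \<union> R"
      "real (height (MR u)) \<le> h + 2 * log 2 n + 6"
      using Z R'[OF _ u'(3)] u by (auto simp: MR_def F_def)
    have "frontier (M u) = frontier u"
      using MR(1) L[OF _ u'(2)] frontier_chain[of u] by (auto simp: M_def u'(1))
    moreover have "subtrees (M u) \<subseteq> F \<union> R"
      using MR(2) L[OF _ u'(2)] u by (auto simp: M_def F_def)
    moreover have "real (height (M u)) \<le> h + 2 * log 2 n + 7"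
      using MR(3) L[OF _ u'(2)] by (auto simp: M_def)
    \<comment> \<open>Passes from the length at \<open>v\<close> to the length at \<open>u\<close>.
      The price is 2, so the constant becomes 7 + 2, within 10.\<close>
    moreover have "log 2 n \<le> 1 + log 2 (length (frontier u))"
    proof -
      have "n \<le> 2 * 2 ^ floor_log (length (frontier u))"
        unfolding u'(4) by (rule floor_log_exp2_ge)
      also have "\<dots> \<le> 2 * length (frontier u)"
        by (simp add: floor_log_exp2_le)
      finally have "log 2 n \<le> log 2 (2 * length (frontier u))"
        using n by (subst log_le_cancel_iff) auto
      then show ?thesis by (simp add: log_mult)
    qed
    ultimately show ?thesis by linarith
  qed
  ultimately show ?thesis by blast
qed

end

text \<open>The rounds of the induction add 10 to the height each, but the logarithm always refers
  to the node itself and does not accumulate. Trees of smaller rank are kept and shared.\<close>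

lemma rank_trees:
  "\<exists>N F. finite F \<and> card F \<le> 31 * card {u \<in> subtrees t. rank t u < r} \<and>
    (\<forall>u \<in> subtrees t. rank t u < r \<longrightarrow> frontier (N u) = frontier u \<and> subtrees (N u) \<subseteq> F \<and>
       real (height (N u)) \<le> 10 * real r + 2 * log 2 (length (frontier u)))"
proof (induction r)
  case 0
  show ?case by (intro exI[of _ id] exI[of _ "{}"]) auto
next
  case (Suc r)
  then obtain N F where F: "finite F" "card F \<le> 31 * card {u \<in> subtrees t. rank t u < r}"
    and N: "\<forall>u \<in> subtrees t. rank t u < r \<longrightarrow> frontier (N u) = frontier u \<and> subtrees (N u) \<subseteq> F \<and>
       real (height (N u)) \<le> 10 * real r + 2 * log 2 (length (frontier u))"
    by (elim exE conjE)
  define U where "U = {v \<in> subtrees t. rank t v = r \<and> (\<forall>x. (x, v) \<notin> heavy t)}"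
  have "\<exists>M G. finite G \<and> card G \<le> 31 * card (heavy_chain t v) \<and>
    (\<forall>u \<in> heavy_chain t v. frontier (M u) = frontier u \<and> subtrees (M u) \<subseteq> G \<union> F \<and>
       real (height (M u)) \<le> 10 * real r + 10 + 2 * log 2 (length (frontier u)))" if "v \<in> U" for v
  proof -
    have v: "v \<in> subtrees t" "rank t v = r" using that by (auto simp: U_def)
    have "\<Union> (subtrees ` N ` {y \<in> subtrees t. rank t y < rank t v}) \<subseteq> F"
      using N v(2) by auto
    moreover have "\<exists>M G. finite G \<and> card G \<le> 31 * card (heavy_chain t v) \<and>
      (\<forall>u \<in> heavy_chain t v. frontier (M u) = frontier u \<and>
         subtrees (M u) \<subseteq> G \<union> \<Union> (subtrees ` N ` {y \<in> subtrees t. rank t y < rank t v}) \<and>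
         real (height (M u)) \<le> 10 * real r + 10 + 2 * log 2 (length (frontier u)))"
      using N v by (intro chain_trees) auto
    ultimately show ?thesis by (meson Un_mono order_refl order_trans)
  qed
  then obtain M G where
    G: "\<And>v. v \<in> U \<Longrightarrow> finite (G v)" "\<And>v. v \<in> U \<Longrightarrow> card (G v) \<le> 31 * card (heavy_chain t v)"
    and M: "\<And>v u. v \<in> U \<Longrightarrow> u \<in> heavy_chain t v \<Longrightarrow> frontier (M v u) = frontier u \<and> subtrees (M v u) \<subseteq> G v \<union> F \<and>
       real (height (M v u)) \<le> 10 * real r + 10 + 2 * log 2 (length (frontier u))"
    by metis
  have "\<exists>v. v \<in> U \<and> u \<in> heavy_chain t v" if "u \<in> subtrees t" "rank t u = r" for u
    using ex_top[OF that(1)] chnD[of u t] that(2) by (fastforce simp: U_def)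
  then obtain top where top: "\<And>u. u \<in> subtrees t \<Longrightarrow> rank t u = r \<Longrightarrow> top u \<in> U \<and> u \<in> heavy_chain t (top u)"
    by metis
  define N' where "N' = (\<lambda>u. if rank t u < r then N u else M (top u) u)"
  define F' where "F' = F \<union> (\<Union>v \<in> U. G v)"
  have finU: "finite U" by (simp add: U_def)
  have "finite F'" using F(1) G(1) finU by (auto simp: F'_def)
  moreover have "card F' \<le> 31 * card {u \<in> subtrees t. rank t u < Suc r}"
  proof -
    have "card (\<Union>v \<in> U. G v) \<le> (\<Sum>v \<in> U. card (G v))"
      using finU by (rule card_UN_le)
    also have "\<dots> \<le> (\<Sum>v \<in> U. 31 * card (heavy_chain t v))"
      by (intro sum_mono G(2))
    also have "\<dots> = 31 * card (\<Union>v \<in> U. heavy_chain t v)"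
    proof -
      \<comment> \<open>Paths with different tops are disjoint, so their budgets add up to 31 for
        each node of rank \<open>r\<close>.\<close>
      have "heavy_chain t v \<inter> heavy_chain t v' = {}" if "v \<in> U" "v' \<in> U" "v \<noteq> v'" for v v'
        using that top_unique[of _ t v v'] by (auto simp: U_def)
      then have "card (\<Union>v \<in> U. heavy_chain t v) = (\<Sum>v \<in> U. card (heavy_chain t v))"
        using finU by (intro card_UN_disjoint) (auto simp: U_def finite_heavy_chain)
      then show ?thesis by (simp add: sum_distrib_left)
    qed
    also have "card (\<Union>v \<in> U. heavy_chain t v) \<le> card {u \<in> subtrees t. rank t u = r}"
      by (intro card_mono) (auto simp: U_def dest: chnD)
    finally have "card F' \<le> 31 * (card {u \<in> subtrees t. rank t u < r} + card {u \<in> subtrees t. rank t u = r})"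
      using F(2) card_Un_le[of F "\<Union>v \<in> U. G v"] by (simp add: F'_def)
    also have "card {u \<in> subtrees t. rank t u < r} + card {u \<in> subtrees t. rank t u = r}
        = card ({u \<in> subtrees t. rank t u < r} \<union> {u \<in> subtrees t. rank t u = r})"
      by (subst card_Un_disjoint) auto
    also have "{u \<in> subtrees t. rank t u < r} \<union> {u \<in> subtrees t. rank t u = r} = {u \<in> subtrees t. rank t u < Suc r}"
      by auto
    finally show ?thesis by simp
  qed
  moreover have "frontier (N' u) = frontier u \<and> subtrees (N' u) \<subseteq> F' \<and>
       real (height (N' u)) \<le> 10 * real (Suc r) + 2 * log 2 (length (frontier u))"
    if u: "u \<in> subtrees t" "rank t u < Suc r" for u
  proof (cases "rank t u < r")
    case True
    with N u(1) show ?thesis by (auto simp: N'_def F'_def)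
  next
    case False
    with u have "rank t u = r" by simp
    from top[OF u(1) this] M[of "top u" u] False show ?thesis
      by (auto simp: N'_def F'_def)
  qed
  ultimately show ?case by blast
qed

theorem balanced_tree:
  "\<exists>t'. frontier t' = frontier t \<and> card (subtrees t') \<le> 31 * card (subtrees t) \<and>
     height t' \<le> 22 * floor_log (length (frontier t)) + 12"
proof -
  define q where "q = floor_log (length (frontier t))"
  have rank: "rank t t < Suc (2 * q)"
    by (simp add: rank_def occurrences_self q_def)
  from rank_trees[of t "Suc (2 * q)"] obtain N F where
    F: "finite F" "card F \<le> 31 * card {u \<in> subtrees t. rank t u < Suc (2 * q)}"
    and N: "\<forall>u \<in> subtrees t. rank t u < Suc (2 * q) \<longrightarrow> frontier (N u) = frontier u \<and> subtrees (N u) \<subseteq> F \<and>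
       real (height (N u)) \<le> 10 * real (Suc (2 * q)) + 2 * log 2 (length (frontier u))"
    by (elim exE conjE)
  have "card (subtrees (N t)) \<le> card F"
    using N[rule_format, OF self_in_subtrees rank] F(1) by (intro card_mono) auto
  also have "\<dots> \<le> 31 * card (subtrees t)"
    using F(2) card_mono[of "subtrees t" "{u \<in> subtrees t. rank t u < Suc (2 * q)}"] by simp
  finally have "card (subtrees (N t)) \<le> 31 * card (subtrees t)" .
  moreover have "log 2 (length (frontier t)) \<le> q + 1"
  proof -
    have "real (length (frontier t)) \<le> real (2 * 2 ^ q)"
      using floor_log_exp2_ge[of "length (frontier t)"] unfolding q_def of_nat_le_iff .
    then have "log 2 (length (frontier t)) \<le> log 2 (2 ^ (q + 1))"
      by (subst log_le_cancel_iff) auto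
    then show ?thesis by (simp only: log_pow_cancel)
  qed
  \<comment> \<open>\<open>10 * (2 * q + 1) + 2 * (q + 1) = 22 * q + 12\<close>.\<close>
  then have "real (height (N t)) \<le> real (22 * q + 12)"
    using N[rule_format, OF self_in_subtrees rank] by simp
  then have "height (N t) \<le> 22 * q + 12" by linarith
  ultimately show ?thesis
    using N[rule_format, OF self_in_subtrees rank] unfolding q_def by blast
qed

section \<open>Trees of straight-line programs\<close>

inductive generates :: "('n, 't) prods \<Rightarrow> 'n \<Rightarrow> 't btree \<Rightarrow> bool" for P where
  "(A, [Tm a]) \<in> P \<Longrightarrow> generates P A (Leaf a)"
| "(A, [Nt C, Nt D]) \<in> P \<Longrightarrow> generates P C l \<Longrightarrow> generates P D r \<Longrightarrow> generates P A (Node l r)"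

fun generates_sym :: "('n, 't) prods \<Rightarrow> ('n, 't) sym \<Rightarrow> 't btree \<Rightarrow> bool" where
  "generates_sym P (Nt A) t = generates P A t"
| "generates_sym P (Tm a) t = (t = Leaf a)"

section \<open>Derivations and derivation trees\<close>

lemma derive_context:
  "(derive_step P)\<^sup>*\<^sup>* \<alpha> \<beta> \<Longrightarrow> (derive_step P)\<^sup>*\<^sup>* (u @ \<alpha> @ v) (u @ \<beta> @ v)"
proof (induction rule: rtranclp_induct)
  case (step \<beta> \<gamma>)
  from step(2) have "derive_step P (u @ \<beta> @ v) (u @ \<gamma> @ v)"
  proof cases
    case (1 A \<alpha>' u' v')
    then show ?thesis using derive_step.intros[OF 1(3), of "u @ u'" "v' @ v"] by simp
  qed
  with step(3) show ?case by (rule rtranclp.rtrancl_into_rtrancl)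
qed auto

lemma generates_derives: "generates P A t \<Longrightarrow> (derive_step P)\<^sup>*\<^sup>* [Nt A] (map Tm (frontier t))"
proof (induction rule: generates.induct)
  case (1 A a)
  then show ?case using derive_step.intros[OF 1, of "[]" "[]"] by auto
next
  case (2 A C D l r)
  have "derive_step P [Nt A] [Nt C, Nt D]"
    using derive_step.intros[OF 2(1), of "[]" "[]"] by simp
  also have "(derive_step P)\<^sup>*\<^sup>* [Nt C, Nt D] (map Tm (frontier l) @ [Nt D])"
    using derive_context[OF 2(4), of "[]" "[Nt D]"] by simp
  also have "(derive_step P)\<^sup>*\<^sup>* (map Tm (frontier l) @ [Nt D]) (map Tm (frontier l) @ map Tm (frontier r))"
    using derive_context[OF 2(5), of "map Tm (frontier l)" "[]"] by simp
  finally show ?case by simp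
qed

text \<open>The derivation is read backwards from the terminal string, with one tree for each symbol
  of the sentential form: undoing a step joins the trees of a right-hand side into one tree.\<close>

lemma derives_generates:
  assumes "(derive_step P)\<^sup>*\<^sup>* \<alpha> (map Tm s)"
    and P: "\<forall>(B, \<alpha>) \<in> P. (\<exists>C D. \<alpha> = [Nt C, Nt D]) \<or> (\<exists>a. \<alpha> = [Tm a])"
  shows "\<exists>ts. list_all2 (generates_sym P) \<alpha> ts \<and> concat (map frontier ts) = s"
  using assms(1)
proof (induction rule: converse_rtranclp_induct)
  case base
  show ?case
    by (intro exI[of _ "map Leaf s"]) (auto simp: list_all2_conv_all_nth comp_def intro: map_idI)
next
  case (step \<alpha> \<beta>)
  from step(3) obtain ts where ts: "list_all2 (generates_sym P) \<beta> ts" "concat (map frontier ts) = s" by blast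
  from step(1) show ?case
  proof cases
    case (1 A \<gamma> u v)
    from ts(1) 1(2) obtain t1 t2 t3 where t:
      "ts = t1 @ t2 @ t3" "list_all2 (generates_sym P) u t1" "list_all2 (generates_sym P) \<gamma> t2"
      "list_all2 (generates_sym P) v t3"
      by (auto simp: list_all2_append1)
    have "\<exists>t. generates P A t \<and> frontier t = concat (map frontier t2)"
    proof -
      from P 1(3) consider C D where "\<gamma> = [Nt C, Nt D]" | a where "\<gamma> = [Tm a]" by blast
      then show ?thesis
      proof cases
        case (1 C D)
        with t(3) obtain l r where "t2 = [l, r]" "generates P C l" "generates P D r"
          by (auto simp: list_all2_Cons1)
        with \<open>(A, \<gamma>) \<in> P\<close> 1 show ?thesis by (intro exI[of _ "Node l r"]) (auto intro: generates.intros)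
      next
        case (2 a)
        with t(3) have "t2 = [Leaf a]" by (auto simp: list_all2_Cons1)
        with \<open>(A, \<gamma>) \<in> P\<close> 2 show ?thesis by (intro exI[of _ "Leaf a"]) (auto intro: generates.intros)
      qed
    qed
    then obtain t' where "generates P A t'" "frontier t' = concat (map frontier t2)" by blast
    with t ts(2) 1(1) show ?thesis
      by (intro exI[of _ "t1 @ [t'] @ t3"]) (auto intro!: list_all2_appendI)
  qed
qed

text \<open>One tree per nonterminal is fixed, by recursion on the least height of a derivation tree;
  this handles nonterminals with several rules and cyclic rules.\<close>

definition low :: "('n, 't) prods \<Rightarrow> nat \<Rightarrow> 'n set" where
  "low P k = {A. \<exists>t. generates P A t \<and> height t \<le> k}"

text \<open>The children of a chosen tree are chosen trees again. Hence every subtree is the tree of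
  some nonterminal, which bounds the number of distinct subtrees.\<close>

definition consistent :: "('n, 't) prods \<Rightarrow> 'n set \<Rightarrow> ('n \<Rightarrow> 't btree) \<Rightarrow> bool" where
  "consistent P X \<tau> \<longleftrightarrow> (\<forall>A \<in> X. (\<exists>a. (A, [Tm a]) \<in> P \<and> \<tau> A = Leaf a) \<or>
     (\<exists>C D. (A, [Nt C, Nt D]) \<in> P \<and> C \<in> X \<and> D \<in> X \<and> \<tau> A = Node (\<tau> C) (\<tau> D)))"

lemma low_cases:
  assumes "A \<in> low P (Suc k)"
  shows "(\<exists>a. (A, [Tm a]) \<in> P) \<or> (\<exists>C D. (A, [Nt C, Nt D]) \<in> P \<and> C \<in> low P k \<and> D \<in> low P k)"
proof -
  from assms obtain t where "generates P A t" "height t \<le> Suc k" by (auto simp: low_def)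
  then show ?thesis by cases (auto simp: low_def)
qed

lemma ex_consistent: "\<exists>\<tau>. consistent P (low P k) \<tau>"
proof (induction k)
  case 0
  have "\<exists>a. (A, [Tm a]) \<in> P" if "A \<in> low P 0" for A
    using that by (auto simp: low_def elim: generates.cases)
  then obtain f where "\<And>A. A \<in> low P 0 \<Longrightarrow> (A, [Tm (f A)]) \<in> P" by metis
  then show ?case by (intro exI[of _ "\<lambda>A. Leaf (f A)"]) (auto simp: consistent_def)
next
  case (Suc k)
  then obtain \<tau> where \<tau>: "consistent P (low P k) \<tau>" by blast
  have "\<exists>t. (\<exists>a. (A, [Tm a]) \<in> P \<and> t = Leaf a) \<or>
      (\<exists>C D. (A, [Nt C, Nt D]) \<in> P \<and> C \<in> low P k \<and> D \<in> low P k \<and> t = Node (\<tau> C) (\<tau> D))"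
    if "A \<in> low P (Suc k)" for A
    using low_cases[OF that] by blast
  then obtain f where f: "\<And>A. A \<in> low P (Suc k) \<Longrightarrow> (\<exists>a. (A, [Tm a]) \<in> P \<and> f A = Leaf a) \<or>
      (\<exists>C D. (A, [Nt C, Nt D]) \<in> P \<and> C \<in> low P k \<and> D \<in> low P k \<and> f A = Node (\<tau> C) (\<tau> D))"
    by metis
  have mono: "low P k \<subseteq> low P (Suc k)" by (auto simp: low_def intro: le_SucI)
  \<comment> \<open>Trees fixed earlier are kept. A new tree has its children in
    \<open>low P k\<close>, where the choice no longer changes.\<close>
  have "consistent P (low P (Suc k)) (\<lambda>A. if A \<in> low P k then \<tau> A else f A)"
    unfolding consistent_def
  proof
    fix A assume A: "A \<in> low P (Suc k)"
    show "(\<exists>a. (A, [Tm a]) \<in> P \<and> (if A \<in> low P k then \<tau> A else f A) = Leaf a) \<or>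
      (\<exists>C D. (A, [Nt C, Nt D]) \<in> P \<and> C \<in> low P (Suc k) \<and> D \<in> low P (Suc k) \<and>
        (if A \<in> low P k then \<tau> A else f A) =
        Node (if C \<in> low P k then \<tau> C else f C) (if D \<in> low P k then \<tau> D else f D))"
    proof (cases "A \<in> low P k")
      case True
      with \<tau> mono show ?thesis unfolding consistent_def by (smt (verit) subsetD)
    next
      case False
      with f[OF A] mono show ?thesis by (smt (verit) subsetD)
    qed
  qed
  then show ?case by blast
qed

lemma consistent_generates:
  assumes "consistent P X \<tau>"
  shows "A \<in> X \<Longrightarrow> generates P A (\<tau> A)"
proof (induction "\<tau> A" arbitrary: A rule: measure_induct_rule[of size])
  case (less A)
  from assms less.prems consider
      a where "(A, [Tm a]) \<in> P" "\<tau> A = Leaf a"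
    | C D where "(A, [Nt C, Nt D]) \<in> P" "C \<in> X" "D \<in> X" "\<tau> A = Node (\<tau> C) (\<tau> D)"
    unfolding consistent_def by blast
  then show ?case
  proof cases
    case 2
    then show ?thesis using less.hyps[of C] less.hyps[of D] by (auto intro: generates.intros)
  qed (auto intro: generates.intros)
qed

lemma subtrees_consistent:
  assumes "consistent P X \<tau>"
  shows "A \<in> X \<Longrightarrow> subtrees (\<tau> A) \<subseteq> \<tau> ` X"
proof (induction "\<tau> A" arbitrary: A rule: measure_induct_rule[of size])
  case (less A)
  from assms less.prems consider
      a where "(A, [Tm a]) \<in> P" "\<tau> A = Leaf a"
    | C D where "(A, [Nt C, Nt D]) \<in> P" "C \<in> X" "D \<in> X" "\<tau> A = Node (\<tau> C) (\<tau> D)"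
    unfolding consistent_def by blast
  then show ?case
  proof cases
    case 1
    then show ?thesis using less.prems by (auto intro: rev_image_eqI)
  next
    case 2
    then have "subtrees (\<tau> C) \<subseteq> \<tau> ` X" "subtrees (\<tau> D) \<subseteq> \<tau> ` X"
      using less.hyps[of C] less.hyps[of D] by auto
    moreover have "subtrees (\<tau> A) = insert (\<tau> A) (subtrees (\<tau> C) \<union> subtrees (\<tau> D))"
      using 2 by simp
    ultimately show ?thesis using less.prems by simp
  qed
qed

lemma slp_tree:
  assumes "is_slp P A s"
  shows "\<exists>t. frontier t = s \<and> card (subtrees t) \<le> card P"
proof -
  from assms have fin: "finite P"
    and P: "\<forall>(B, \<alpha>) \<in> P. (\<exists>C D. \<alpha> = [Nt C, Nt D]) \<or> (\<exists>a. \<alpha> = [Tm a])"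
    and L: "Lang P A = {s}"
    by (auto simp: is_slp_def)
  from L have "(derive_step P)\<^sup>*\<^sup>* [Nt A] (map Tm s)" by (auto simp: Lang_def)
  from derives_generates[OF this P] obtain t where t: "generates P A t"
    by (auto simp: list_all2_Cons1)
  define k where "k = height t"
  have A: "A \<in> low P k" using t by (auto simp: low_def k_def)
  obtain \<tau> where \<tau>: "consistent P (low P k) \<tau>" using ex_consistent by blast
  \<comment> \<open>The chosen tree may differ from the derivation found above, but the language
    contains no other string than \<open>s\<close>.\<close>
  have "frontier (\<tau> A) \<in> Lang P A"
    using generates_derives[OF consistent_generates[OF \<tau> A]] by (simp add: Lang_def)
  then have "frontier (\<tau> A) = s" using L by simp
  moreover have "card (subtrees (\<tau> A)) \<le> card P"
  proof -
    have low: "low P k \<subseteq> fst ` P"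
    proof
      fix B assume "B \<in> low P k"
      then obtain t' where "generates P B t'" by (auto simp: low_def)
      then show "B \<in> fst ` P" by cases (auto intro: rev_image_eqI)
    qed
    moreover have "finite (fst ` P)" using fin by simp
    ultimately have "finite (low P k)" by (rule finite_subset)
    then have "card (subtrees (\<tau> A)) \<le> card (low P k)"
      using subtrees_consistent[OF \<tau> A] by (meson card_image_le card_mono finite_imageI order_trans)
    also have "\<dots> \<le> card (fst ` P)"
      using low fin by (intro card_mono) auto
    also have "\<dots> \<le> card P"
      using fin by (rule card_image_le)
    finally show ?thesis .
  qed
  ultimately show ?thesis by blast
qed

section \<open>The query program\<close>

text \<open>Registers: 0 and 1 hold the range, counted from 0, half-open and relative to the current node,
  whose address is in 2, position in 3 and length of the left child in 4; 5 and 6 hold the key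
  and the position of the best candidate; 10 and 11 hold the position and the address of the right
  child at the split. The loops start at 6 (descent), 26 (suffix of the left child, where
  ties replace the candidate) and 54 (prefix of the right child, where they do not). A leaf is
  recognised by the length 0 of its left child.\<close>

definition query :: program where
  "query =
    [Const 7 1, Op Sub 0 0 7, Const 13 2, Const 14 3, Const 15 4, Op Sub 5 12 7,
     Op Add 8 2 13, Load 4 8, JumpEq 4 12 19, JumpLess 4 1 12,
     Load 2 2, Jump 6,
     JumpLess 0 4 21, Op Sub 0 0 4, Op Sub 1 1 4, Op Add 3 3 4, Op Add 8 2 7, Load 2 8, Jump 6,
     Op Add 0 3 7, Jump 80,
     Op Add 10 3 4, Op Add 8 2 7, Load 11 8, Op Sub 1 1 4, Load 2 2,
     Op Add 8 2 13, Load 4 8, JumpEq 4 12 47, JumpLess 0 4 35,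
     Op Sub 0 0 4, Op Add 3 3 4, Op Add 8 2 7, Load 2 8, Jump 26,
     Op Add 8 2 7, Load 16 8, Op Add 8 16 14, Load 9 8, JumpLess 5 9 45,
     Op Add 5 9 12, Op Add 8 16 15, Load 6 8, Op Add 6 6 3, Op Add 6 6 4,
     Load 2 2, Jump 26,
     Op Add 8 2 14, Load 9 8, JumpLess 5 9 52, Op Add 5 9 12, Op Add 6 3 12,
     Op Add 2 11 12, Op Add 3 10 12,
     Op Add 8 2 13, Load 4 8, JumpEq 4 12 74, JumpLess 4 1 60,
     Load 2 2, Jump 54,
     Load 16 2, Op Add 8 16 14, Load 9 8, JumpLess 9 5 65, Jump 69,
     Op Add 5 9 12, Op Add 8 16 15, Load 6 8, Op Add 6 6 3,
     Op Sub 1 1 4, Op Add 3 3 4, Op Add 8 2 7, Load 2 8, Jump 54,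
     Op Add 8 2 14, Load 9 8, JumpLess 9 5 78, Jump 79, Op Add 6 3 12,
     Op Add 0 6 7]"

definition query_step :: "nat \<Rightarrow> config \<Rightarrow> config" where
  "query_step w = step w query"

lemma query_step_simp:
  "n < 80 \<Longrightarrow> query_step w \<lparr>pc = n, regs = R, mem = m\<rparr> = exec_instr w (query ! n) \<lparr>pc = n, regs = R, mem = m\<rparr>"
  by (simp add: query_step_def step_def halted_def query_def)

text \<open>Peels off the first step instead of the last, so that a run of known length is executed
  forwards.\<close>

lemma funpow_numeral_unfold: "(f ^^ numeral k) x = (f ^^ pred_numeral k) (f x)"
  by (simp add: numeral_eq_Suc funpow_swap1)

section \<open>Leftmost minima of half-open ranges counted from 0\<close>

definition leftmost_min :: "int list \<Rightarrow> nat \<Rightarrow> nat \<Rightarrow> nat \<Rightarrow> bool" where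
  "leftmost_min S lo hi k \<longleftrightarrow> lo \<le> k \<and> k < hi \<and> (\<forall>l. lo \<le> l \<and> l < hi \<longrightarrow> S ! k \<le> S ! l) \<and>
     (\<forall>l. lo \<le> l \<and> l < k \<longrightarrow> S ! k < S ! l)"

text \<open>The right minimum must be strictly smaller to win; this decides the direction of every
  key comparison in the program.\<close>

lemma leftmost_min_merge:
  assumes "leftmost_min S lo mid k" "leftmost_min S mid hi k'"
  shows "leftmost_min S lo hi (if S ! k' < S ! k then k' else k)"
proof -
  have k: "lo \<le> k" "k < mid" "mid \<le> k'" "k' < hi"
    and left: "\<And>l. lo \<le> l \<Longrightarrow> l < mid \<Longrightarrow> S ! k \<le> S ! l" "\<And>l. lo \<le> l \<Longrightarrow> l < k \<Longrightarrow> S ! k < S ! l"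
    and right: "\<And>l. mid \<le> l \<Longrightarrow> l < hi \<Longrightarrow> S ! k' \<le> S ! l" "\<And>l. mid \<le> l \<Longrightarrow> l < k' \<Longrightarrow> S ! k' < S ! l"
    using assms by (auto simp: leftmost_min_def)
  show ?thesis
  proof (cases "S ! k' < S ! k")
    case True
    have "S ! k' \<le> S ! l \<and> (l < k' \<longrightarrow> S ! k' < S ! l)" if "lo \<le> l" "l < hi" for l
      using that True left(1)[of l] right[of l] by (cases "l < mid") auto
    with True k show ?thesis by (simp add: leftmost_min_def)
  next
    case False
    have "S ! k \<le> S ! l \<and> (l < k \<longrightarrow> S ! k < S ! l)" if "lo \<le> l" "l < hi" for l
      using that False left[of l] right(1)[of l] k by (cases "l < mid") auto
    with False k show ?thesis by (simp add: leftmost_min_def)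
  qed
qed

lemma ex_leftmost_min:
  assumes "lo < hi"
  shows "\<exists>k. leftmost_min S lo hi k"
  using assms
proof (induction hi)
  case (Suc hi)
  have hi: "leftmost_min S hi (Suc hi) hi"
    by (auto simp: leftmost_min_def less_Suc_eq_le)
  show ?case
  proof (cases "lo = hi")
    case True
    with hi show ?thesis by blast
  next
    case False
    with Suc obtain k where "leftmost_min S lo hi k" by auto
    from leftmost_min_merge[OF this hi] show ?thesis by blast
  qed
qed auto

lemma leftmost_min_rmq:
  assumes "leftmost_min S (i - 1) j k" "1 \<le> i"
  shows "rmq S i j = k + 1"
  unfolding rmq_def
proof (rule Least_equality)
  show "k + 1 \<in> {i..j} \<and> (\<forall>l \<in> {i..j}. S ! (k + 1 - 1) \<le> S ! (l - 1))"
  proof (intro conjI ballI)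
    show "k + 1 \<in> {i..j}" using assms by (auto simp: leftmost_min_def)
    fix l assume "l \<in> {i..j}"
    then have "i - 1 \<le> l - 1 \<and> l - 1 < j" using assms(2) by auto
    then show "S ! (k + 1 - 1) \<le> S ! (l - 1)" using assms(1) by (simp add: leftmost_min_def)
  qed
next
  fix y assume y: "y \<in> {i..j} \<and> (\<forall>l \<in> {i..j}. S ! (y - 1) \<le> S ! (l - 1))"
  show "k + 1 \<le> y"
  proof (rule ccontr)
    assume "\<not> k + 1 \<le> y"
    then have "i - 1 \<le> y - 1 \<and> y - 1 < k" using assms y by auto
    then have "S ! k < S ! (y - 1)" using assms(1) by (simp add: leftmost_min_def)
    moreover have "S ! (y - 1) \<le> S ! k"
      using y[THEN conjunct2, rule_format, of "k + 1"] assms by (auto simp: leftmost_min_def)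
    ultimately show False by simp
  qed
qed

definition occurs :: "'a list \<Rightarrow> nat \<Rightarrow> 'a btree \<Rightarrow> bool" where
  "occurs S q x \<longleftrightarrow> q + length (frontier x) \<le> length S \<and> take (length (frontier x)) (drop q S) = frontier x"

lemma occurs_Node:
  assumes "occurs S q (Node l r)"
  shows "occurs S q l" "occurs S (q + length (frontier l)) r"
proof -
  have *: "q + (length (frontier l) + length (frontier r)) \<le> length S"
    "take (length (frontier l) + length (frontier r)) (drop q S) = frontier l @ frontier r"
    using assms by (auto simp: occurs_def)
  have "take (length (frontier l)) (drop q S) = take (length (frontier l)) (take (length (frontier l) + length (frontier r)) (drop q S))"
    by (simp add: min_def)
  also have "\<dots> = frontier l" by (simp add: *(2))
  finally show "occurs S q l" using *(1) by (simp add: occurs_def)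
  have "take (length (frontier r)) (drop (q + length (frontier l)) S)
      = drop (length (frontier l)) (take (length (frontier l) + length (frontier r)) (drop q S))"
    by (simp add: drop_take add.commute)
  also have "\<dots> = frontier r" by (simp add: *(2))
  finally show "occurs S (q + length (frontier l)) r" using *(1) by (simp add: occurs_def)
qed

lemma occurs_nth:
  assumes "occurs S q x" "k < length (frontier x)"
  shows "frontier x ! k = S ! (q + k)"
proof -
  have "frontier x ! k = take (length (frontier x)) (drop q S) ! k"
    using assms by (simp add: occurs_def)
  then show ?thesis using assms by (simp add: occurs_def)
qed

lemma leftmost_min_occurs:
  assumes "occurs S q x" "leftmost_min (frontier x) 0 (length (frontier x)) k"
  shows "leftmost_min S q (q + length (frontier x)) (q + k)"
proof -
  have "S ! (q + k) \<le> S ! l" if "q \<le> l" "l < q + length (frontier x)" for l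
  proof -
    have "frontier x ! k \<le> frontier x ! (l - q)" "l - q < length (frontier x)"
      using assms(2) that by (auto simp: leftmost_min_def)
    then show ?thesis
      using assms that occurs_nth[OF assms(1), of k] occurs_nth[OF assms(1), of "l - q"]
      by (auto simp: leftmost_min_def)
  qed
  moreover have "S ! (q + k) < S ! l" if "q \<le> l" "l < q + k" for l
  proof -
    have "frontier x ! k < frontier x ! (l - q)" "l - q < length (frontier x)"
      using assms(2) that by (auto simp: leftmost_min_def)
    then show ?thesis
      using assms that occurs_nth[OF assms(1), of k] occurs_nth[OF assms(1), of "l - q"]
      by (auto simp: leftmost_min_def)
  qed
  ultimately show ?thesis using assms(2) by (auto simp: leftmost_min_def)
qed

text \<open>The position of the minimum is relative to the start of the subtree, so one record
  serves all occurrences of the subtree.\<close>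

definition node_rec :: "(nat \<Rightarrow> nat) \<Rightarrow> (int btree \<Rightarrow> nat) \<Rightarrow> (int \<Rightarrow> nat) \<Rightarrow> int btree \<Rightarrow> bool" where
  "node_rec m p f x \<longleftrightarrow>
    (case x of Leaf a \<Rightarrow> m (p x + 2) = 0
     | Node l r \<Rightarrow> m (p x) = p l \<and> m (p x + 1) = p r \<and> m (p x + 2) = length (frontier l)) \<and>
    leftmost_min (frontier x) 0 (length (frontier x)) (m (p x + 4)) \<and> m (p x + 3) = f (frontier x ! m (p x + 4))"

text \<open>The bounds keep addresses, positions, keys and the constants of the program below
  \<open>2 ^ w\<close>, so that machine arithmetic agrees with that of the natural numbers. The root
  is at address 0, the initial content of the address register.\<close>

locale query_memory =
  fixes w :: nat and m :: "nat \<Rightarrow> nat" and p :: "int btree \<Rightarrow> nat" and f :: "int \<Rightarrow> nat"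
    and t :: "int btree"
  assumes recs: "\<And>x. x \<in> subtrees t \<Longrightarrow> node_rec m p f x"
    and ptrs: "\<And>x. x \<in> subtrees t \<Longrightarrow> p x + 4 < 2 ^ w"
    and key_less: "\<And>a b. a \<in> set (frontier t) \<Longrightarrow> b \<in> set (frontier t) \<Longrightarrow> f a < f b \<longleftrightarrow> a < b"
    and key_bound: "\<And>a. a \<in> set (frontier t) \<Longrightarrow> f a < 2 ^ w"
    and length_bound: "length (frontier t) < 2 ^ w"
    and word: "4 < (2::nat) ^ w"
    and root: "p t = 0"
begin

abbreviation "S \<equiv> frontier t"

text \<open>The program contains no \<open>Store\<close>, so one memory \<open>m\<close> serves for
  the whole run and the data structure stays intact.\<close>

definition run :: "nat \<Rightarrow> nat \<Rightarrow> (nat \<Rightarrow> nat) \<Rightarrow> nat \<Rightarrow> (nat \<Rightarrow> nat) \<Rightarrow> bool" where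
  "run k n R n' R' \<longleftrightarrow>
    (\<exists>j \<le> k. (query_step w ^^ j) \<lparr>pc = n, regs = R, mem = m\<rparr> = \<lparr>pc = n', regs = R', mem = m\<rparr>)"

lemma runI: "(query_step w ^^ k) \<lparr>pc = n, regs = R, mem = m\<rparr> = \<lparr>pc = n', regs = R', mem = m\<rparr> \<Longrightarrow> run k n R n' R'"
  by (auto simp: run_def)

lemma run_trans: "run k n R n' R' \<Longrightarrow> run k' n' R' n'' R'' \<Longrightarrow> k + k' \<le> l \<Longrightarrow> run l n R n'' R''"
  unfolding run_def
proof (elim exE conjE)
  fix i j
  assume "i \<le> k" "j \<le> k'" "k + k' \<le> l"
    "(query_step w ^^ i) \<lparr>pc = n, regs = R, mem = m\<rparr> = \<lparr>pc = n', regs = R', mem = m\<rparr>"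
    "(query_step w ^^ j) \<lparr>pc = n', regs = R', mem = m\<rparr> = \<lparr>pc = n'', regs = R'', mem = m\<rparr>"
  then show "\<exists>j \<le> l. (query_step w ^^ j) \<lparr>pc = n, regs = R, mem = m\<rparr> = \<lparr>pc = n'', regs = R'', mem = m\<rparr>"
    by (intro exI[of _ "j + i"]) (auto simp: funpow_add)
qed

lemma run_mono: "run k n R n' R' \<Longrightarrow> k \<le> l \<Longrightarrow> run l n R n' R'"
  unfolding run_def by (meson le_trans)

definition regs_ok :: "(nat \<Rightarrow> nat) \<Rightarrow> bool" where
  "regs_ok R \<longleftrightarrow> R 7 = 1 \<and> R 12 = 0 \<and> R 13 = 2 \<and> R 14 = 3 \<and> R 15 = 4"

lemma add_word: "(a::nat) + b < 2 ^ w \<Longrightarrow> take_bit w (a + b) = a + b"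
  by (simp add: take_bit_nat_eq_self)

lemma self_word: "(a::nat) < 2 ^ w \<Longrightarrow> take_bit w a = a"
  by (simp add: take_bit_nat_eq_self)

lemma sub_word: "(b::nat) \<le> a \<Longrightarrow> a < 2 ^ w \<Longrightarrow> take_bit w (a + 2 ^ w - b) = a - b"
proof -
  assume *: "b \<le> a" "a < 2 ^ w"
  then have "a + 2 ^ w - b = a - b + 2 ^ w" by simp
  then show ?thesis using * by (simp only: take_bit_nat_def mod_add_self2) simp
qed

text \<open>The largest word stands for the absence of a candidate. No key exceeds it, and in the
  loop for suffixes a tie replaces the candidate, so the first subtree met is taken even if its key
  is \<open>2 ^ w - 1\<close>.\<close>

definition best :: "nat \<Rightarrow> nat \<Rightarrow> (nat \<Rightarrow> nat) \<Rightarrow> bool" where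
  "best lo hi R \<longleftrightarrow> (lo = hi \<and> R 5 = 2 ^ w - 1) \<or> (leftmost_min S lo hi (R 6) \<and> hi \<le> length S \<and> R 5 = f (S ! R 6))"

lemmas exec = funpow_numeral_unfold query_step_simp query_def add_word sub_word self_word

lemma leafs: "Leaf a \<in> subtrees t \<Longrightarrow> m (Suc (Suc (p (Leaf a)))) = 0"
  using recs[of "Leaf a"] by (simp add: node_rec_def)

lemma nodes:
  assumes "Node l r \<in> subtrees t"
  shows "m (p (Node l r)) = p l" "m (Suc (p (Node l r))) = p r" "m (Suc (Suc (p (Node l r)))) = length (frontier l)"
  using recs[OF assms] by (simp_all add: node_rec_def)

lemma minima:
  assumes "x \<in> subtrees t" "occurs S q x"
  shows "leftmost_min S q (q + length (frontier x)) (q + m (p x + 4))" "m (p x + 3) = f (S ! (q + m (p x + 4)))"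
    "m (p x + 4) < length (frontier x)"
proof -
  have *: "leftmost_min (frontier x) 0 (length (frontier x)) (m (p x + 4))" "m (p x + 3) = f (frontier x ! m (p x + 4))"
    using recs[OF assms(1)] by (simp_all add: node_rec_def)
  show "leftmost_min S q (q + length (frontier x)) (q + m (p x + 4))"
    using assms(2) *(1) by (rule leftmost_min_occurs)
  show "m (p x + 4) < length (frontier x)" using *(1) by (simp add: leftmost_min_def)
  then show "m (p x + 3) = f (S ! (q + m (p x + 4)))"
    using *(2) occurs_nth[OF assms(2)] by simp
qed

text \<open>The new minimum lies to the left of the candidate and wins ties. If the candidate
  survives, its key is below that of \<open>k\<close>, which rules out the empty candidate.\<close>

lemma best_left:
  assumes "best mid hi R" "leftmost_min S lo mid k" "mid \<le> length S" "hi \<le> length S"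
  shows "R 5 < f (S ! k) \<Longrightarrow> best lo hi R"
    and "\<not> R 5 < f (S ! k) \<Longrightarrow> leftmost_min S lo hi k"
proof -
  have k: "k < length S" "lo \<le> k" "k < mid" using assms by (auto simp: leftmost_min_def)
  have kb: "f (S ! k) < 2 ^ w" using key_bound[of "S ! k"] k by simp
  show "best lo hi R" if "R 5 < f (S ! k)"
  proof -
    from that kb assms(1) have *: "leftmost_min S mid hi (R 6)" "R 5 = f (S ! R 6)"
      by (auto simp: best_def)
    then have "R 6 < length S" using assms(4) by (auto simp: leftmost_min_def)
    with that * k have "S ! R 6 < S ! k" using key_less by simp
    with leftmost_min_merge[OF assms(2) *(1)] * assms(4) show ?thesis by (simp add: best_def)
  qed
  show "leftmost_min S lo hi k" if "\<not> R 5 < f (S ! k)"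
  proof (cases "mid = hi")
    case True
    with assms show ?thesis by simp
  next
    case False
    with assms(1) have *: "leftmost_min S mid hi (R 6)" "R 5 = f (S ! R 6)"
      by (auto simp: best_def)
    then have "R 6 < length S" using assms(4) by (auto simp: leftmost_min_def)
    with that * k have "\<not> S ! R 6 < S ! k" using key_less by simp
    with leftmost_min_merge[OF assms(2) *(1)] show ?thesis by simp
  qed
qed

lemma best_right:
  assumes "leftmost_min S lo mid (R 6)" "R 5 = f (S ! R 6)" "leftmost_min S mid hi k" "hi \<le> length S"
  shows "f (S ! k) < R 5 \<Longrightarrow> leftmost_min S lo hi k"
    and "\<not> f (S ! k) < R 5 \<Longrightarrow> leftmost_min S lo hi (R 6)"
proof -
  have "k < length S" "R 6 < length S" using assms by (auto simp: leftmost_min_def)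
  then have "f (S ! k) < R 5 \<longleftrightarrow> S ! k < S ! R 6"
    using key_less assms(2) by simp
  with leftmost_min_merge[OF assms(1,3)]
  show "f (S ! k) < R 5 \<Longrightarrow> leftmost_min S lo hi k" "\<not> f (S ! k) < R 5 \<Longrightarrow> leftmost_min S lo hi (R 6)"
    by simp_all
qed

text \<open>The bound is taken as the exact number of steps; executing them then determines
  \<open>R'\<close>.\<close>

lemma ex_run:
  "\<exists>R'. (query_step w ^^ k) \<lparr>pc = n, regs = R, mem = m\<rparr> = \<lparr>pc = n', regs = R', mem = m\<rparr> \<and> Q R' \<Longrightarrow>
   \<exists>R'. run k n R n' R' \<and> Q R'"
  by (auto intro: runI)

section \<open>Symbolic execution of the branches of the three loops\<close>

lemma suffix_right:
  assumes "Node l r \<in> subtrees t" "R 2 = p (Node l r)" "regs_ok R" "length (frontier l) \<le> R 0" "R 0 < 2 ^ w"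
    "R 3 + length (frontier l) < 2 ^ w"
  shows "\<exists>R'. run 9 26 R 26 R' \<and> regs_ok R' \<and> R' 2 = p r \<and> R' 3 = R 3 + length (frontier l) \<and>
    R' 0 = R 0 - length (frontier l) \<and> (\<forall>k \<in> {1, 5, 6, 10, 11}. R' k = R k)"
  using assms nodes[OF assms(1)] ptrs[OF assms(1)] word length_frontier_pos[of l]
  by (intro ex_run) (simp add: exec regs_ok_def)

lemma suffix_left_skip:
  assumes "Node l r \<in> subtrees t" "R 2 = p (Node l r)" "regs_ok R" "R 0 < length (frontier l)"
    "R 5 < m (p r + 3)"
  shows "\<exists>R'. run 11 26 R 26 R' \<and> regs_ok R' \<and> R' 2 = p l \<and>
    (\<forall>k \<in> {0, 1, 3, 5, 6, 10, 11}. R' k = R k)"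
  using assms nodes[OF assms(1)] ptrs[OF assms(1)] ptrs[OF subtrees_Node_in(2)[OF assms(1)]]
  by (intro ex_run) (simp add: exec regs_ok_def)

lemma suffix_left_take:
  assumes "Node l r \<in> subtrees t" "R 2 = p (Node l r)" "regs_ok R" "R 0 < length (frontier l)"
    "\<not> R 5 < m (p r + 3)" "m (p r + 3) < 2 ^ w" "R 3 + length (frontier l) + m (p r + 4) < 2 ^ w"
  shows "\<exists>R'. run 16 26 R 26 R' \<and> regs_ok R' \<and> R' 2 = p l \<and>
    R' 5 = m (p r + 3) \<and> R' 6 = R 3 + length (frontier l) + m (p r + 4) \<and>
    (\<forall>k \<in> {0, 1, 3, 10, 11}. R' k = R k)"
  using assms nodes[OF assms(1)] ptrs[OF assms(1)] ptrs[OF subtrees_Node_in(2)[OF assms(1)]]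
  by (intro ex_run) (simp add: exec regs_ok_def)

lemma suffix_leaf_skip:
  assumes "Leaf a \<in> subtrees t" "R 2 = p (Leaf a)" "regs_ok R" "R 5 < m (p (Leaf a) + 3)"
  shows "\<exists>R'. run 6 26 R 52 R' \<and> regs_ok R' \<and> (\<forall>k \<in> {1, 5, 6, 10, 11}. R' k = R k)"
  using assms leafs[OF assms(1)] ptrs[OF assms(1)]
  by (intro ex_run) (simp add: exec regs_ok_def)

lemma suffix_leaf_take:
  assumes "Leaf a \<in> subtrees t" "R 2 = p (Leaf a)" "regs_ok R" "\<not> R 5 < m (p (Leaf a) + 3)"
    "m (p (Leaf a) + 3) < 2 ^ w" "R 3 < 2 ^ w"
  shows "\<exists>R'. run 8 26 R 52 R' \<and> regs_ok R' \<and> R' 5 = m (p (Leaf a) + 3) \<and> R' 6 = R 3 \<and>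
    (\<forall>k \<in> {1, 10, 11}. R' k = R k)"
  using assms leafs[OF assms(1)] ptrs[OF assms(1)]
  by (intro ex_run) (simp add: exec regs_ok_def)

lemma prefix_left:
  assumes "Node l r \<in> subtrees t" "R 2 = p (Node l r)" "regs_ok R" "R 1 \<le> length (frontier l)"
  shows "\<exists>R'. run 6 54 R 54 R' \<and> regs_ok R' \<and> R' 2 = p l \<and> (\<forall>k \<in> {1, 3, 5, 6}. R' k = R k)"
  using assms nodes[OF assms(1)] ptrs[OF assms(1)] length_frontier_pos[of l]
  by (intro ex_run) (simp add: exec regs_ok_def)

lemma prefix_right_skip:
  assumes "Node l r \<in> subtrees t" "R 2 = p (Node l r)" "regs_ok R" "length (frontier l) < R 1"
    "\<not> m (p l + 3) < R 5" "R 1 < 2 ^ w" "R 3 + length (frontier l) < 2 ^ w"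
  shows "\<exists>R'. run 14 54 R 54 R' \<and> regs_ok R' \<and> R' 2 = p r \<and> R' 1 = R 1 - length (frontier l) \<and>
    R' 3 = R 3 + length (frontier l) \<and> (\<forall>k \<in> {5, 6}. R' k = R k)"
  using assms nodes[OF assms(1)] ptrs[OF assms(1)] ptrs[OF subtrees_Node_in(1)[OF assms(1)]] word
  by (intro ex_run) (simp add: exec regs_ok_def)

lemma prefix_right_take:
  assumes "Node l r \<in> subtrees t" "R 2 = p (Node l r)" "regs_ok R" "length (frontier l) < R 1"
    "m (p l + 3) < R 5" "m (p l + 3) < 2 ^ w" "R 1 < 2 ^ w" "R 3 + length (frontier l) < 2 ^ w"
    "R 3 + m (p l + 4) < 2 ^ w"
  shows "\<exists>R'. run 17 54 R 54 R' \<and> regs_ok R' \<and> R' 2 = p r \<and> R' 1 = R 1 - length (frontier l) \<and>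
    R' 3 = R 3 + length (frontier l) \<and> R' 5 = m (p l + 3) \<and> R' 6 = R 3 + m (p l + 4)"
  using assms nodes[OF assms(1)] ptrs[OF assms(1)] ptrs[OF subtrees_Node_in(1)[OF assms(1)]] word
  by (intro ex_run) (simp add: exec regs_ok_def)

lemma prefix_leaf_skip:
  assumes "Leaf a \<in> subtrees t" "R 2 = p (Leaf a)" "regs_ok R" "\<not> m (p (Leaf a) + 3) < R 5" "R 6 + 1 < 2 ^ w"
  shows "\<exists>R'. run 8 54 R 80 R' \<and> R' 0 = R 6 + 1"
  using assms leafs[OF assms(1)] ptrs[OF assms(1)]
  by (intro ex_run) (simp add: exec regs_ok_def)

lemma prefix_leaf_take:
  assumes "Leaf a \<in> subtrees t" "R 2 = p (Leaf a)" "regs_ok R" "m (p (Leaf a) + 3) < R 5" "R 3 + 1 < 2 ^ w"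
  shows "\<exists>R'. run 8 54 R 80 R' \<and> R' 0 = R 3 + 1"
  using assms leafs[OF assms(1)] ptrs[OF assms(1)]
  by (intro ex_run) (simp add: exec regs_ok_def)

lemma middle:
  assumes "regs_ok R" "R 10 < 2 ^ w" "R 11 < 2 ^ w"
  shows "\<exists>R'. run 2 52 R 54 R' \<and> regs_ok R' \<and> R' 2 = R 11 \<and> R' 3 = R 10 \<and>
    (\<forall>k \<in> {1, 5, 6}. R' k = R k)"
  using assms by (intro ex_run) (simp add: exec regs_ok_def)

lemma descend_left:
  assumes "Node l r \<in> subtrees t" "R 2 = p (Node l r)" "regs_ok R" "R 1 \<le> length (frontier l)"
  shows "\<exists>R'. run 6 6 R 6 R' \<and> regs_ok R' \<and> R' 2 = p l \<and> (\<forall>k \<in> {0, 1, 3, 5}. R' k = R k)"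
  using assms nodes[OF assms(1)] ptrs[OF assms(1)] length_frontier_pos[of l]
  by (intro ex_run) (simp add: exec regs_ok_def)

lemma descend_right:
  assumes "Node l r \<in> subtrees t" "R 2 = p (Node l r)" "regs_ok R" "length (frontier l) \<le> R 0" "R 0 < R 1"
    "R 1 < 2 ^ w" "R 3 + length (frontier l) < 2 ^ w"
  shows "\<exists>R'. run 11 6 R 6 R' \<and> regs_ok R' \<and> R' 2 = p r \<and> R' 0 = R 0 - length (frontier l) \<and>
    R' 1 = R 1 - length (frontier l) \<and> R' 3 = R 3 + length (frontier l) \<and> R' 5 = R 5"
  using assms nodes[OF assms(1)] ptrs[OF assms(1)] word length_frontier_pos[of l]
  by (intro ex_run) (simp add: exec regs_ok_def)

lemma descend_split:
  assumes "Node l r \<in> subtrees t" "R 2 = p (Node l r)" "regs_ok R" "R 0 < length (frontier l)" "length (frontier l) < R 1"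
    "R 1 < 2 ^ w" "R 3 + length (frontier l) < 2 ^ w"
  shows "\<exists>R'. run 10 6 R 26 R' \<and> regs_ok R' \<and> R' 2 = p l \<and> R' 1 = R 1 - length (frontier l) \<and>
    R' 10 = R 3 + length (frontier l) \<and> R' 11 = p r \<and> (\<forall>k \<in> {0, 3, 5}. R' k = R k)"
  using assms nodes[OF assms(1)] ptrs[OF assms(1)] word length_frontier_pos[of l]
  by (intro ex_run) (simp add: exec regs_ok_def)

lemma descend_leaf:
  assumes "Leaf a \<in> subtrees t" "R 2 = p (Leaf a)" "regs_ok R" "R 3 + 1 < 2 ^ w"
  shows "\<exists>R'. run 5 6 R 80 R' \<and> R' 0 = R 3 + 1"
  using assms leafs[OF assms(1)] ptrs[OF assms(1)]
  by (intro ex_run) (simp add: exec regs_ok_def)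

lemma init:
  assumes "1 \<le> R 0" "R 0 < 2 ^ w" "R 12 = 0"
  shows "\<exists>R'. run 6 0 R 6 R' \<and> regs_ok R' \<and> R' 0 = R 0 - 1 \<and> R' 5 = 2 ^ w - 1 \<and>
    (\<forall>k \<in> {1, 2, 3}. R' k = R k)"
proof -
  have "3 \<le> w"
  proof (rule ccontr)
    assume "\<not> 3 \<le> w"
    then have "(2::nat) ^ w \<le> 2 ^ 2" by (intro power_increasing) auto
    with word show False by simp
  qed
  then show ?thesis
    using assms word by (intro ex_run) (simp add: exec regs_ok_def)
qed

text \<open>The candidate covers the range from the end of the string of \<open>x\<close> to
  \<open>hi\<close>. Going right keeps that end; going left first merges in the whole right child.
  The longest branch takes 16 steps, within 17 per level.\<close>

lemma suffix_loop:
  assumes "x \<in> subtrees t" "occurs S q x" "R 2 = p x" "R 3 = q" "R 0 < length (frontier x)" "regs_ok R"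
    "best (q + length (frontier x)) hi R" "hi \<le> length S"
  shows "\<exists>R'. run (17 * height x + 8) 26 R 52 R' \<and> regs_ok R' \<and>
    R' 1 = R 1 \<and> R' 10 = R 10 \<and> R' 11 = R 11 \<and>
    leftmost_min S (q + R 0) hi (R' 6) \<and> R' 5 = f (S ! R' 6)"
  using assms
proof (induction x arbitrary: R q)
  case (Leaf a)
  have q: "q < length S" using Leaf(2) by (simp add: occurs_def)
  have m3: "m (p (Leaf a) + 3) = f (S ! q)" "leftmost_min S q (q + 1) q" "R 0 = 0"
    using minima[OF Leaf(1,2)] Leaf(5) by auto
  have b: "best (q + 1) hi R" using Leaf(7) by simp
  show ?case
  proof (cases "R 5 < f (S ! q)")
    case True
    then obtain R' where R': "run 6 26 R 52 R'" "regs_ok R'" "\<forall>k \<in> {1, 5, 6, 10, 11}. R' k = R k"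
      using suffix_leaf_skip[OF Leaf(1,3,6)] m3(1) by auto
    from best_left(1)[OF b m3(2) _ Leaf(8) True] q have "best q hi R" by simp
    moreover have "f (S ! q) < 2 ^ w" using q key_bound by simp
    ultimately have "leftmost_min S q hi (R 6)" "R 5 = f (S ! R 6)"
      using True by (auto simp: best_def)
    with R' m3(3) show ?thesis by (intro exI[of _ R']) (auto elim: run_mono)
  next
    case False
    moreover have "f (S ! q) < 2 ^ w" "q < 2 ^ w" using q key_bound length_bound by auto
    ultimately obtain R' where R': "run 8 26 R 52 R'" "regs_ok R'" "R' 5 = f (S ! q)" "R' 6 = q"
        "\<forall>k \<in> {1, 10, 11}. R' k = R k"
      using suffix_leaf_take[OF Leaf(1,3,6)] m3(1) Leaf(4) by auto
    from best_left(2)[OF b m3(2) _ Leaf(8) False] q have "leftmost_min S q hi q" by simp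
    with R' m3(3) show ?thesis by (intro exI[of _ R']) auto
  qed
next
  case (Node l r)
  let ?n = "length (frontier l)"
  have l: "l \<in> subtrees t" "occurs S q l" and r: "r \<in> subtrees t" "occurs S (q + ?n) r"
    using subtrees_Node_in[OF Node.prems(1)] occurs_Node[OF Node.prems(2)] by auto
  have len: "q + ?n + length (frontier r) \<le> length S" using r(2) by (simp add: occurs_def)
  show ?case
  proof (cases "?n \<le> R 0")
    case True
    then obtain R1 where R1: "run 9 26 R 26 R1" "regs_ok R1" "R1 2 = p r" "R1 3 = q + ?n"
        "R1 0 = R 0 - ?n" "\<forall>k \<in> {1, 5, 6, 10, 11}. R1 k = R k"
      using suffix_right[OF Node.prems(1,3,6)] Node.prems(4,5) len length_bound by auto
    have "R1 0 < length (frontier r)" using R1(5) Node.prems(5) True by simp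
    moreover have "best (q + ?n + length (frontier r)) hi R1"
      using Node.prems(7) R1(6) by (simp add: best_def add.assoc)
    ultimately obtain R' where R': "run (17 * height r + 8) 26 R1 52 R'" "regs_ok R'" "R' 1 = R1 1"
        "R' 10 = R1 10" "R' 11 = R1 11" "leftmost_min S (q + ?n + R1 0) hi (R' 6)" "R' 5 = f (S ! R' 6)"
      using Node.IH(2)[OF r R1(3,4) _ R1(2)] Node.prems(8) by blast
    have "run (17 * height (Node l r) + 8) 26 R 52 R'"
      using R1(1) R'(1) by (rule run_trans) simp
    with R' R1 True show ?thesis by (intro exI[of _ R']) simp
  next
    case False
    define k where "k = q + ?n + m (p r + 4)"
    have k: "leftmost_min S (q + ?n) (q + ?n + length (frontier r)) k" "m (p r + 3) = f (S ! k)"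
      using minima[OF r] by (auto simp: k_def)
    have kS: "k < length S" using k(1) len by (simp add: leftmost_min_def)
    have b: "best (q + ?n + length (frontier r)) hi R" using Node.prems(7) by (simp add: add.assoc)
    have "\<exists>R1. run 16 26 R 26 R1 \<and> regs_ok R1 \<and> R1 2 = p l \<and> best (q + ?n) hi R1 \<and>
      (\<forall>k \<in> {0, 1, 3, 10, 11}. R1 k = R k)"
    proof (cases "R 5 < f (S ! k)")
      case True
      then obtain R1 where R1: "run 11 26 R 26 R1" "regs_ok R1" "R1 2 = p l"
          "\<forall>k \<in> {0, 1, 3, 5, 6, 10, 11}. R1 k = R k"
        using suffix_left_skip[OF Node.prems(1,3,6)] False k(2) by auto
      have "best (q + ?n) hi R"
        using best_left(1)[OF b k(1) len Node.prems(8) True] .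
      with R1 have "best (q + ?n) hi R1" by (simp add: best_def)
      with R1 show ?thesis by (intro exI[of _ R1]) (auto elim: run_mono)
    next
      case F: False
      moreover have "f (S ! k) < 2 ^ w" "k < 2 ^ w" using kS key_bound length_bound by auto
      ultimately obtain R1 where R1: "run 16 26 R 26 R1" "regs_ok R1" "R1 2 = p l"
          "R1 5 = f (S ! k)" "R1 6 = k" "\<forall>k \<in> {0, 1, 3, 10, 11}. R1 k = R k"
        using suffix_left_take[OF Node.prems(1,3,6)] False k(2) Node.prems(4) by (auto simp: k_def)
      have "leftmost_min S (q + ?n) hi k"
        using best_left(2)[OF b k(1) len Node.prems(8) F] .
      with R1 Node.prems(8) have "best (q + ?n) hi R1" by (simp add: best_def)
      with R1 show ?thesis by blast
    qed
    then obtain R1 where R1: "run 16 26 R 26 R1" "regs_ok R1" "R1 2 = p l" "best (q + ?n) hi R1"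
      "\<forall>k \<in> {0, 1, 3, 10, 11}. R1 k = R k" by blast
    have "R1 3 = q" "R1 0 < ?n" using R1(5) Node.prems(4) False by auto
    then obtain R' where R': "run (17 * height l + 8) 26 R1 52 R'" "regs_ok R'" "R' 1 = R1 1"
        "R' 10 = R1 10" "R' 11 = R1 11" "leftmost_min S (q + R1 0) hi (R' 6)" "R' 5 = f (S ! R' 6)"
      using Node.IH(1)[OF l R1(3) _ _ R1(2,4)] Node.prems(8) by blast
    have "run (17 * height (Node l r) + 8) 26 R 52 R'"
      using R1(1) R'(1) by (rule run_trans) simp
    with R' R1 show ?thesis by (intro exI[of _ R']) simp
  qed
qed

text \<open>The candidate covers the range from \<open>lo\<close> up to the start of
  \<open>x\<close> and is never empty. A prefix that ends with the left child goes left, which keeps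
  \<open>0 < R 1\<close> and avoids an empty prefix of the right child. The longest branch takes 17
  steps.\<close>

lemma prefix_loop:
  assumes "x \<in> subtrees t" "occurs S q x" "R 2 = p x" "R 3 = q" "0 < R 1" "R 1 \<le> length (frontier x)"
    "regs_ok R" "leftmost_min S lo q (R 6)" "R 5 = f (S ! R 6)"
  shows "\<exists>R' k. run (17 * height x + 8) 54 R 80 R' \<and> R' 0 = k + 1 \<and> leftmost_min S lo (q + R 1) k"
  using assms
proof (induction x arbitrary: R q)
  case (Leaf a)
  have q: "q < length S" using Leaf(2) by (simp add: occurs_def)
  have m3: "m (p (Leaf a) + 3) = f (S ! q)" "leftmost_min S q (q + 1) q" "R 1 = 1"
    using minima[OF Leaf(1,2)] Leaf(5,6) by auto
  have b: "R 6 < q" using Leaf(8) by (simp add: leftmost_min_def)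
  show ?case
  proof (cases "f (S ! q) < R 5")
    case False
    then obtain R' where R': "run 8 54 R 80 R'" "R' 0 = R 6 + 1"
      using prefix_leaf_skip[OF Leaf(1,3,7)] m3(1) b q length_bound by auto
    from best_right(2)[OF Leaf(8,9) m3(2) _ False] q have "leftmost_min S lo (q + R 1) (R 6)"
      using m3(3) by simp
    with R' show ?thesis by (intro exI[of _ R'] exI[of _ "R 6"]) simp
  next
    case True
    then obtain R' where R': "run 8 54 R 80 R'" "R' 0 = q + 1"
      using prefix_leaf_take[OF Leaf(1,3,7)] m3(1) Leaf(4) q length_bound by auto
    from best_right(1)[OF Leaf(8,9) m3(2) _ True] q have "leftmost_min S lo (q + R 1) q"
      using m3(3) by simp
    with R' show ?thesis by (intro exI[of _ R'] exI[of _ q]) simp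
  qed
next
  case (Node l r)
  let ?n = "length (frontier l)"
  have l: "l \<in> subtrees t" "occurs S q l" and r: "r \<in> subtrees t" "occurs S (q + ?n) r"
    using subtrees_Node_in[OF Node.prems(1)] occurs_Node[OF Node.prems(2)] by auto
  have len: "q + ?n + length (frontier r) \<le> length S" using r(2) by (simp add: occurs_def)
  show ?case
  proof (cases "R 1 \<le> ?n")
    case True
    then obtain R1 where R1: "run 6 54 R 54 R1" "regs_ok R1" "R1 2 = p l"
        "\<forall>k \<in> {1, 3, 5, 6}. R1 k = R k"
      using prefix_left[OF Node.prems(1,3,7)] by auto
    have "R1 3 = q" "0 < R1 1" "R1 1 \<le> ?n" "leftmost_min S lo q (R1 6)" "R1 5 = f (S ! R1 6)"
      using R1(4) Node.prems True by auto
    then obtain R' k where R': "run (17 * height l + 8) 54 R1 80 R'" "R' 0 = k + 1"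
        "leftmost_min S lo (q + R1 1) k"
      using Node.IH(1)[OF l R1(3) _ _ _ R1(2)] by blast
    have "run (17 * height (Node l r) + 8) 54 R 80 R'"
      using R1(1) R'(1) by (rule run_trans) simp
    with R' R1 show ?thesis by (intro exI[of _ R'] exI[of _ k]) simp
  next
    case False
    define k where "k = q + m (p l + 4)"
    have k: "leftmost_min S q (q + ?n) k" "m (p l + 3) = f (S ! k)"
      using minima[OF l] by (auto simp: k_def)
    have kS: "k < length S" using k(1) len by (simp add: leftmost_min_def)
    have words: "R 1 < 2 ^ w" "R 3 + ?n < 2 ^ w" "f (S ! k) < 2 ^ w" "k < 2 ^ w"
      using Node.prems(4,6) len length_bound kS key_bound by auto
    have "\<exists>R1. run 17 54 R 54 R1 \<and> regs_ok R1 \<and> R1 2 = p r \<and> R1 1 = R 1 - ?n \<and> R1 3 = q + ?n \<and>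
      leftmost_min S lo (q + ?n) (R1 6) \<and> R1 5 = f (S ! R1 6)"
    proof (cases "f (S ! k) < R 5")
      case F: False
      then obtain R1 where R1: "run 14 54 R 54 R1" "regs_ok R1" "R1 2 = p r"
          "R1 1 = R 1 - ?n" "R1 3 = q + ?n" "R1 5 = R 5" "R1 6 = R 6"
        using prefix_right_skip[OF Node.prems(1,3,7)] False k(2) words Node.prems(4) by auto
      have "leftmost_min S lo (q + ?n) (R 6)"
        using best_right(2)[OF Node.prems(8,9) k(1) _ F] len by simp
      with R1 Node.prems(9) show ?thesis by (intro exI[of _ R1]) (auto elim: run_mono)
    next
      case True
      then obtain R1 where R1: "run 17 54 R 54 R1" "regs_ok R1" "R1 2 = p r"
          "R1 1 = R 1 - ?n" "R1 3 = q + ?n" "R1 5 = f (S ! k)" "R1 6 = k"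
        using prefix_right_take[OF Node.prems(1,3,7)] False k(2) words Node.prems(4)
        by (auto simp: k_def)
      have "leftmost_min S lo (q + ?n) k"
        using best_right(1)[OF Node.prems(8,9) k(1) _ True] len by simp
      with R1 show ?thesis by (intro exI[of _ R1]) simp
    qed
    then obtain R1 where R1: "run 17 54 R 54 R1" "regs_ok R1" "R1 2 = p r" "R1 1 = R 1 - ?n"
      "R1 3 = q + ?n" "leftmost_min S lo (q + ?n) (R1 6)" "R1 5 = f (S ! R1 6)" by blast
    have "0 < R1 1" "R1 1 \<le> length (frontier r)" using R1(4) Node.prems(6) False by auto
    then obtain R' k where R': "run (17 * height r + 8) 54 R1 80 R'" "R' 0 = k + 1"
        "leftmost_min S lo (q + ?n + R1 1) k"
      using Node.IH(2)[OF r R1(3,5) _ _ R1(2,6,7)] by blast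
    have "run (17 * height (Node l r) + 8) 54 R 80 R'"
      using R1(1) R'(1) by (rule run_trans) simp
    with R' R1(4) False show ?thesis by (intro exI[of _ R'] exI[of _ k]) simp
  qed
qed

text \<open>Below the split both other loops run, hence \<open>34 = 2 * 17\<close> steps per level.
  The constant is 10 for the split, 8 for the end of each loop and 2 between them.\<close>

lemma descend_loop:
  assumes "x \<in> subtrees t" "occurs S q x" "R 2 = p x" "R 3 = q" "R 0 < R 1" "R 1 \<le> length (frontier x)"
    "regs_ok R" "R 5 = 2 ^ w - 1"
  shows "\<exists>R' k. run (34 * height x + 28) 6 R 80 R' \<and> R' 0 = k + 1 \<and> leftmost_min S (q + R 0) (q + R 1) k"
  using assms
proof (induction x arbitrary: R q)
  case (Leaf a)
  have q: "q < length S" using Leaf(2) by (simp add: occurs_def)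
  have "leftmost_min S q (q + 1) q" "R 0 = 0" "R 1 = 1"
    using minima[OF Leaf(1,2)] Leaf(5,6) by auto
  moreover obtain R' where "run 5 6 R 80 R'" "R' 0 = q + 1"
    using descend_leaf[OF Leaf(1,3,7)] Leaf(4) q length_bound by auto
  ultimately show ?case by (intro exI[of _ R'] exI[of _ q]) (auto elim: run_mono)
next
  case (Node l r)
  let ?n = "length (frontier l)"
  have l: "l \<in> subtrees t" "occurs S q l" and r: "r \<in> subtrees t" "occurs S (q + ?n) r"
    using subtrees_Node_in[OF Node.prems(1)] occurs_Node[OF Node.prems(2)] by auto
  have len: "q + ?n + length (frontier r) \<le> length S" using r(2) by (simp add: occurs_def)
  have words: "R 1 < 2 ^ w" "R 3 + ?n < 2 ^ w"
    using Node.prems(4,6) len length_bound by auto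
  consider "R 1 \<le> ?n" | "?n \<le> R 0" | "R 0 < ?n" "?n < R 1" by linarith
  then show ?case
  proof cases
    case 1
    then obtain R1 where R1: "run 6 6 R 6 R1" "regs_ok R1" "R1 2 = p l"
        "\<forall>k \<in> {0, 1, 3, 5}. R1 k = R k"
      using descend_left[OF Node.prems(1,3,7)] by auto
    have "R1 3 = q" "R1 0 < R1 1" "R1 1 \<le> ?n" "R1 5 = 2 ^ w - 1"
      using R1(4) Node.prems 1 by auto
    then obtain R' k where R': "run (34 * height l + 28) 6 R1 80 R'" "R' 0 = k + 1"
        "leftmost_min S (q + R1 0) (q + R1 1) k"
      using Node.IH(1)[OF l R1(3) _ _ _ R1(2)] by blast
    have "run (34 * height (Node l r) + 28) 6 R 80 R'"
      using R1(1) R'(1) by (rule run_trans) simp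
    with R' R1 show ?thesis by (intro exI[of _ R'] exI[of _ k]) simp
  next
    case 2
    then obtain R1 where R1: "run 11 6 R 6 R1" "regs_ok R1" "R1 2 = p r" "R1 3 = q + ?n"
        "R1 0 = R 0 - ?n" "R1 1 = R 1 - ?n" "R1 5 = R 5"
      using descend_right[OF Node.prems(1,3,7)] Node.prems(4,5) words by auto
    have "R1 0 < R1 1" "R1 1 \<le> length (frontier r)" "R1 5 = 2 ^ w - 1"
      using R1 Node.prems 2 by auto
    then obtain R' k where R': "run (34 * height r + 28) 6 R1 80 R'" "R' 0 = k + 1"
        "leftmost_min S (q + ?n + R1 0) (q + ?n + R1 1) k"
      using Node.IH(2)[OF r R1(3,4) _ _ R1(2)] by blast
    have "run (34 * height (Node l r) + 28) 6 R 80 R'"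
      using R1(1) R'(1) by (rule run_trans) simp
    with R' R1(5,6) 2 Node.prems(5) show ?thesis by (intro exI[of _ R'] exI[of _ k]) simp
  next
    case 3
    then obtain R1 where R1: "run 10 6 R 26 R1" "regs_ok R1" "R1 2 = p l" "R1 1 = R 1 - ?n"
        "R1 10 = q + ?n" "R1 11 = p r" "\<forall>k \<in> {0, 3, 5}. R1 k = R k"
      using descend_split[OF Node.prems(1,3,7)] Node.prems(4) words by auto
    have "R1 3 = q" "R1 0 < ?n" "best (q + ?n) (q + ?n) R1" "q + ?n \<le> length S"
      using R1(7) Node.prems 3 len by (auto simp: best_def)
    from suffix_loop[OF l R1(3) this(1,2) R1(2) this(3,4)] R1(7)
    obtain R2 where R2: "run (17 * height l + 8) 26 R1 52 R2" "regs_ok R2" "R2 1 = R1 1"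
        "R2 10 = R1 10" "R2 11 = R1 11" "leftmost_min S (q + R 0) (q + ?n) (R2 6)" "R2 5 = f (S ! R2 6)"
      by auto
    have "R2 10 < 2 ^ w" "R2 11 < 2 ^ w"
      using R2 R1 words Node.prems(4) ptrs[OF r(1)] by auto
    from middle[OF R2(2) this] obtain R3 where R3: "run 2 52 R2 54 R3" "regs_ok R3"
        "R3 2 = p r" "R3 3 = q + ?n" "\<forall>k \<in> {1, 5, 6}. R3 k = R2 k"
      using R1(5,6) R2(4,5) by auto
    have "0 < R3 1" "R3 1 \<le> length (frontier r)" "leftmost_min S (q + R 0) (q + ?n) (R3 6)" "R3 5 = f (S ! R3 6)"
      using R3(5) R2 R1(4) Node.prems(6) 3 by auto
    from prefix_loop[OF r R3(3,4) this(1,2) R3(2) this(3,4)]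
    obtain R' k where R': "run (17 * height r + 8) 54 R3 80 R'" "R' 0 = k + 1"
        "leftmost_min S (q + R 0) (q + ?n + R3 1) k"
      by blast
    have "run (17 * height r + 10) 52 R2 80 R'"
      using R3(1) R'(1) by (rule run_trans) simp
    then have "run (17 * height l + 17 * height r + 18) 26 R1 80 R'"
      by (rule run_trans[OF R2(1)]) simp
    then have "run (34 * height (Node l r) + 28) 6 R 80 R'"
      by (rule run_trans[OF R1(1)]) simp
    moreover have "q + ?n + R3 1 = q + R 1"
      using R3(5) R2(3) R1(4) 3 by simp
    then have "leftmost_min S (q + R 0) (q + R 1) k" using R'(3) by (simp only:)
    ultimately show ?thesis using R'(2) by blast
  qed
qed

lemma query_correct:
  assumes "1 \<le> i" "i \<le> j" "j \<le> length S"
  shows "\<exists>c. halts_within w query (34 * height t + 34) (start i j m) c \<and> regs c 0 = rmq S i j \<and> mem c = m"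
proof -
  define R where "R = ((\<lambda>_. 0)(0 := i, 1 := j) :: nat \<Rightarrow> nat)"
  have R: "1 \<le> R 0" "R 0 < 2 ^ w" "R 12 = 0"
    using assms length_bound by (auto simp: R_def)
  from init[OF R] obtain R1 where R1': "run 6 0 R 6 R1" "regs_ok R1" "R1 0 = R 0 - 1" "R1 5 = 2 ^ w - 1"
      "\<forall>k \<in> {1, 2, 3}. R1 k = R k"
    by blast
  then have R1: "run 6 0 R 6 R1" "regs_ok R1" "R1 0 = i - 1" "R1 5 = 2 ^ w - 1"
      "R1 1 = j" "R1 2 = p t" "R1 3 = 0"
    by (auto simp: R_def root)
  have "occurs S 0 t" by (simp add: occurs_def)
  moreover have "R1 0 < R1 1" "R1 1 \<le> length S" using R1(3,5) assms by auto
  ultimately obtain R' k where "run (34 * height t + 28) 6 R1 80 R'" "R' 0 = k + 1"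
      "leftmost_min S (0 + R1 0) (0 + R1 1) k"
    using descend_loop[OF self_in_subtrees _ R1(6,7) _ _ R1(2,4)] by blast
  then have R': "run (34 * height t + 28) 6 R1 80 R'" "R' 0 = k + 1" "leftmost_min S (i - 1) j k"
    using R1(3,5) by simp_all
  \<comment> \<open>Six instructions precede the descent, and \<open>6 + 28 = 34\<close>.\<close>
  have "run (34 * height t + 34) 0 R 80 R'"
    using R1(1) R'(1) by (rule run_trans) simp
  then have "halts_within w query (34 * height t + 34) (start i j m) \<lparr>pc = 80, regs = R', mem = m\<rparr>"
    by (auto simp: run_def halts_within_def halted_def query_def query_step_def[abs_def] start_def R_def)
  moreover have "R' 0 = rmq S i j"
    using leftmost_min_rmq[OF R'(3) assms(1)] R'(2) by simp
  ultimately show ?thesis by (intro exI[of _ "\<lparr>pc = 80, regs = R', mem = m\<rparr>"]) simp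
qed

end

section \<open>The data structure\<close>

lemma ex_query_memory:
  fixes t :: "int btree"
  assumes g: "5 * card (subtrees t) \<le> 2 ^ w" and n: "length (frontier t) < 2 ^ w" and w: "4 < (2::nat) ^ w"
  shows "\<exists>D p f. length D = 5 * card (subtrees t) \<and> (\<forall>x \<in> set D. x < 2 ^ w) \<and>
    (\<forall>m. stores m D \<longrightarrow> query_memory w m p f t)"
proof -
  \<comment> \<open>The number of distinct smaller entries is at most the length of the string, so
    it fits into a word whatever the size of the integers.\<close>
  define f where "f = (\<lambda>a. card {b \<in> set (frontier t). b < a})"
  have f_less: "f a < f b \<longleftrightarrow> a < b" if "a \<in> set (frontier t)" "b \<in> set (frontier t)" for a b
  proof -
    have "f a < f b" if "a < b" "a \<in> set (frontier t)" for a b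
      unfolding f_def using that by (intro psubset_card_mono) auto
    with that show ?thesis by (metis linorder_neqE order_less_asym order_less_irrefl)
  qed
  have f_bound: "f a < 2 ^ w" for a
  proof -
    have "f a \<le> card (set (frontier t))" unfolding f_def by (intro card_mono) auto
    also have "\<dots> \<le> length (frontier t)" by (rule card_length)
    finally show ?thesis using n by simp
  qed
  obtain xs where xs: "set xs = subtrees t - {t}" "distinct xs"
    using finite_distinct_list[of "subtrees t - {t}"] by auto
  \<comment> \<open>The root comes first and thereby gets address 0.\<close>
  define ns where "ns = t # xs"
  have ns: "set ns = subtrees t" "distinct ns"
    using xs insert_Diff[OF self_in_subtrees[of t]] by (simp_all add: ns_def)
  then have len: "length ns = card (subtrees t)" by (metis distinct_card)
  have "\<exists>i < length ns. ns ! i = x" if "x \<in> subtrees t" for x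
    using that in_set_conv_nth[of x ns] by (simp add: ns(1))
  then obtain ix where ix: "\<And>x. x \<in> subtrees t \<Longrightarrow> ix x < length ns \<and> ns ! ix x = x" by metis
  have ix0: "ix t = 0"
    using ix[OF self_in_subtrees[of t]] nth_eq_iff_index_eq[OF ns(2), of "ix t" 0] by (simp add: ns_def)
  have "\<exists>k. leftmost_min (frontier x) 0 (length (frontier x)) k" for x by (rule ex_leftmost_min) simp
  then obtain am where am: "\<And>x. leftmost_min (frontier x) 0 (length (frontier x)) (am x)" by metis
  define wd where "wd = (\<lambda>x. case x of Leaf a \<Rightarrow> [0, 0, 0, f (frontier x ! am x), am x]
    | Node l r \<Rightarrow> [5 * ix l, 5 * ix r, length (frontier l), f (frontier x ! am x), am x])"
  \<comment> \<open>The node with number \<open>i\<close> occupies the cells from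
    \<open>5 * i\<close> to \<open>5 * i + 4\<close>.\<close>
  define D where "D = map (\<lambda>a. wd (ns ! (a div 5)) ! (a mod 5)) [0..<5 * length ns]"
  have ix_bound: "5 * ix x + c < 5 * length ns" if "x \<in> subtrees t" "c < 5" for x c
    using ix[OF that(1)] that(2) by linarith
  have nth_D: "D ! (5 * ix x + c) = wd x ! c" if "x \<in> subtrees t" "c < 5" for x c
    using ix_bound[OF that] ix[OF that(1)] that(2) by (simp add: D_def)
  have wd_bound: "wd x ! c < 2 ^ w" if x: "x \<in> subtrees t" and c: "c < 5" for x c
  proof -
    have "am x < 2 ^ w"
      using am[of x] length_frontier_subtrees[OF x] n by (simp add: leftmost_min_def)
    moreover have "5 * ix l < 2 ^ w \<and> 5 * ix r < 2 ^ w \<and> length (frontier l) < 2 ^ w" if "x = Node l r" for l r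
      using that subtrees_Node_in[of l r t] x ix_bound[of l 0] ix_bound[of r 0] length_frontier_subtrees[of l t] n g len
      by auto
    moreover have "c \<in> {0, 1, 2, 3, 4}" using c by auto
    ultimately show ?thesis using f_bound by (cases x) (auto simp: wd_def)
  qed
  have "length D = 5 * card (subtrees t)" by (simp add: D_def len)
  moreover have "\<forall>x \<in> set D. x < 2 ^ w"
  proof
    fix y assume "y \<in> set D"
    then obtain a where a: "a < 5 * length ns" "y = wd (ns ! (a div 5)) ! (a mod 5)"
      by (auto simp: D_def)
    then have "a div 5 < length ns" by linarith
    then have "ns ! (a div 5) \<in> subtrees t" using ns(1) nth_mem by blast
    then show "y < 2 ^ w" using a(2) wd_bound by simp
  qed
  moreover have "query_memory w m (\<lambda>x. 5 * ix x) f t" if "stores m D" for m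
  proof
    fix x assume x: "x \<in> subtrees t"
    have m: "m (5 * ix x + c) = wd x ! c" if "c < 5" for c
      using \<open>stores m D\<close> ix_bound[OF x that] nth_D[OF x that] by (simp add: stores_def D_def)
    show "node_rec m (\<lambda>x. 5 * ix x) f x"
      using m[of 0] m[of 1] m[of 2] m[of 3] m[of 4] am[of x]
      by (cases x) (auto simp: node_rec_def wd_def)
    show "5 * ix x + 4 < 2 ^ w" using ix_bound[OF x, of 4] g len by simp
  qed (use f_less f_bound n w ix0 in auto)
  ultimately show ?thesis by blast
qed

lemma halts_within_mono: "halts_within w q k c c' \<Longrightarrow> k \<le> l \<Longrightarrow> halts_within w q l c c'"
  unfolding halts_within_def using order_trans by blast

theorem theorem1:
  "\<exists>(query :: program) (K :: nat) (space :: nat \<Rightarrow> nat) (time :: nat \<Rightarrow> nat).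
     (\<lambda>g. real (space g)) \<in> O(\<lambda>g. real g) \<and>
     (\<lambda>n. real (time n)) \<in> O(\<lambda>n. log 2 (real n)) \<and>
     (\<forall>(n :: nat) (\<sigma> :: int) (S :: int list) (G :: (nat, int) prods) (A :: nat) (w :: nat).
        length S = n \<and> set S \<subseteq> {0..<\<sigma>} \<and> is_slp G A S \<and> real w \<ge> log 2 (real n) + real K \<longrightarrow>
        (\<exists>D :: nat list.
           length D \<le> space (card G) \<and> length D \<le> 2 ^ w \<and> (\<forall>x \<in> set D. x < 2 ^ w) \<and>
           answers_rmq w query (time n) D S))"
proof (rule exI[of _ query], rule exI[of _ 10], rule exI[of _ "\<lambda>g. 155 * g"],
    rule exI[of _ "\<lambda>n. 748 * floor_log n + 442"], intro conjI allI impI)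
  \<comment> \<open>Five words for each of at most \<open>31 * g\<close> distinct subtrees.\<close>
  show "(\<lambda>g. real (155 * g)) \<in> O(\<lambda>g. real g)"
    by simp
  \<comment> \<open>The bound \<open>34 * height + 34\<close> for a height of at most
    \<open>22 * floor_log n + 12\<close>: \<open>748 = 34 * 22\<close> and
    \<open>442 = 34 * 12 + 34\<close>.\<close>
  show "(\<lambda>n. real (748 * floor_log n + 442)) \<in> O(\<lambda>n. log 2 (real n))"
  proof (rule bigoI)
    \<comment> \<open>\<open>1190 = 748 + 442\<close>; from \<open>n = 2\<close> on the logarithm is
      at least 1 and absorbs the constant.\<close>
    show "\<forall>\<^sub>F n in at_top. norm (real (748 * floor_log n + 442)) \<le> 1190 * norm (log 2 (real n))"
    proof (rule eventually_mono[OF eventually_ge_at_top[of 2]])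
      fix n :: nat
      assume n: "2 \<le> n"
      then have 1: "1 \<le> log 2 (real n)" by (simp add: le_log_iff)
      have "real (floor_log n) \<le> log 2 (real n)"
        using n 1 by (simp add: floor_log_altdef)
      with 1 show "norm (real (748 * floor_log n + 442)) \<le> 1190 * norm (log 2 (real n))"
        by simp
    qed
  qed
next
  fix n :: nat and \<sigma> :: int and S :: "int list" and G :: "(nat, int) prods" and A w :: nat
  assume *: "length S = n \<and> set S \<subseteq> {0..<\<sigma>} \<and> is_slp G A S \<and> real w \<ge> log 2 (real n) + real 10"
  then have len: "length S = n" and slp: "is_slp G A S" and wn: "real w \<ge> log 2 (real n) + real 10"
    by simp_all
  from slp_tree[OF slp] obtain t0 where t0: "frontier t0 = S" "card (subtrees t0) \<le> card G"
    by (elim exE conjE)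
  from balanced_tree[of t0] obtain t where
    t: "frontier t = S" "card (subtrees t) \<le> 31 * card (subtrees t0)" "height t \<le> 22 * floor_log n + 12"
    by (auto simp only: t0(1) len)
  have n: "0 < n" using len t(1) length_frontier_pos[of t] by simp
  have "real n * 2 ^ 10 = 2 powr (log 2 (real n) + real 10)"
    using n by (simp add: powr_add powr_realpow)
  also have "\<dots> \<le> 2 powr real w"
    using wn by (intro powr_mono) auto
  also have "\<dots> = 2 ^ w"
    by (simp add: powr_realpow)
  finally have "real (n * 2 ^ 10) \<le> real (2 ^ w)"
    by simp
  \<comment> \<open>The 10 extra bits make room for all addresses: there are at most
    \<open>5 * 31 * (2 * n) = 310 * n\<close> cells.\<close>
  then have w: "n * 1024 \<le> 2 ^ w"
    by (simp only: of_nat_le_iff) simp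
  \<comment> \<open>For the word size the subtrees are counted through the leaves, because the
    number of rules of \<open>G\<close> is not bounded in terms of \<open>n\<close>.\<close>
  have "card (subtrees t0) \<le> 2 * n"
    using card_subtrees_le[of t0] t0(1) len by simp
  then have small: "5 * card (subtrees t) \<le> 2 ^ w" "length (frontier t) < 2 ^ w" "4 < (2::nat) ^ w"
    using t n w len by auto
  from ex_query_memory[OF this] obtain D p f where
    D: "length D = 5 * card (subtrees t)" "\<forall>x \<in> set D. x < 2 ^ w"
    and mem: "\<And>m. stores m D \<Longrightarrow> query_memory w m p f t"
    by blast
  have "answers_rmq w query (748 * floor_log n + 442) D S"
    unfolding answers_rmq_def
  proof (intro allI impI, elim conjE)
    fix i j m
    assume ij: "1 \<le> i" "i \<le> j" "j \<le> length S" and m: "stores m D"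
    from mem[OF m] interpret query_memory w m p f t .
    from query_correct[OF ij(1,2)] ij(3) t(1) obtain c where
      c: "halts_within w query (34 * height t + 34) (start i j m) c" "regs c 0 = rmq S i j" "mem c = m"
      by auto
    from c(1) have "halts_within w query (748 * floor_log n + 442) (start i j m) c"
      by (rule halts_within_mono) (use t(3) in simp)
    with c m show "\<exists>c. halts_within w query (748 * floor_log n + 442) (start i j m) c \<and>
        regs c 0 = rmq S i j \<and> stores (mem c) D"
      by auto
  qed
  moreover have "length D \<le> 155 * card G"
    using D(1) t(2) t0(2) by simp
  ultimately show "\<exists>D. length D \<le> 155 * card G \<and> length D \<le> 2 ^ w \<and> (\<forall>x \<in> set D. x < 2 ^ w) \<and>
      answers_rmq w query (748 * floor_log n + 442) D S"
    using D small(1) by (intro exI[of _ D]) simp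
qed


end
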